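(* Let $n\ge2$, $1\le p,q\le\infty$ and $1<r\le\infty$. Then the trace operator $\mathrm{Tr}: f(x)\mapsto f(\bar x,0)$, $\bar x=(x_1,\dots,x_{n-1})$, is not bounded from $M^{0}_{p,q,r}(\mathbb{R}^n)$ to $M^0_{p,q}(\mathbb{R}^{n-1})$: there is no constant $C>0$ such that $\mathrm{Tr}f$ is defined and $\|\mathrm{Tr} f\|_{M^0_{p,q}(\mathbb{R}^{n-1})}\le C\|f\|_{M^0_{p,q,r}(\mathbb{R}^n)}$ for all $f\in M^0_{p,q,r}(\mathbb{R}^n)$.
   Context: Notation: $\mathscr{F},\mathscr{F}^{-1}$ are the Fourier transform and its inverse. For $k\in\mathbb{Z}^n$, $\bar k=(k_1,\dots,k_{n-1})$. Frequency-uniform decomposition: let $\eta:\mathbb{R}\to[0,1]$ be a smooth function with $\eta(t)=1$ for $|t|\le1$ and $\eta(t)=0$ for $|t|\ge2$. In dimension $d$, for $k\in\mathbb{Z}^d$ put $$\psi_k(\xi)=\frac{\prod_{i=1}^d\eta(2(\xi_i-k_i))}{\sum_{m\in\mathbb{Z}^d}\prod_{i=1}^d\eta(2(\xi_i-m_i))},\qquad \Box_k=\mathscr{F}^{-1}\psi_k\mathscr{F}.$$ $M^0_{p,q}(\mathbb{R}^d)$: all tempered distributions $f$ with $\|f\|_{M^0_{p,q}}=\big(\sum_{k\in\mathbb{Z}^d}\|\Box_kf\|_{L^p(\mathbb{R}^d)}^q\big)^{1/q}<\infty$. $M^0_{p,q,r}(\mathbb{R}^n)$: all tempered distributions $f$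 with $$\|f\|_{M^0_{p,q,r}}=\Big(\sum_{k_n\in\mathbb{Z}}\Big(\sum_{\bar k\in\mathbb{Z}^{n-1}}\|\Box_kf\|^q_{L^p(\mathbb{R}^n)}\Big)^{r/q}\Big)^{1/r}<\infty,\qquad k=(\bar k,k_n).$$ Suprema replace sums when an index is $\infty$. Trace: for a tempered distribution $f$, $f(\bar x,0)$ is understood as $\sum_{k\in\mathbb{Z}^n}(\Box_kf)(\bar x,0)$ whenever this converges in $\mathscr{S}'(\mathbb{R}^{n-1})$; for a Schwartz function $f$ it is the ordinary restriction. *)

theory Defs
  imports "HOL-Analysis.Analysis" "HOL-Probability.Essential_Supremum"
begin

section \<open>Schwartz functions and tempered distributions\<close>

fun iter_partial :: "'a::euclidean_space list \<Rightarrow> ('a \<Rightarrow> 'b::real_normed_vector) \<Rightarrow> 'a \<Rightarrow> 'b" where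
  "iter_partial [] f = f"
| "iter_partial (b # bs) f = (\<lambda>x. frechet_derivative (iter_partial bs f) (at x) b)"

definition smooth :: "('a::euclidean_space \<Rightarrow> 'b::real_normed_vector) \<Rightarrow> bool" where
  "smooth f \<longleftrightarrow> (\<forall>bs x. set bs \<subseteq> Basis \<longrightarrow> iter_partial bs f differentiable (at x))"

definition schwartz :: "('a::euclidean_space \<Rightarrow> complex) \<Rightarrow> bool" where
  "schwartz f \<longleftrightarrow> smooth f \<and>
     (\<forall>N bs. set bs \<subseteq> Basis \<longrightarrow>
        bdd_above (range (\<lambda>x. (1 + norm x) ^ N * norm (iter_partial bs f x))))"

definition schwartz_seminorm :: "nat \<Rightarrow> ('a::euclidean_space \<Rightarrow> complex) \<Rightarrow> real" where
  "schwartz_seminorm N f =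
     (\<Sum>bs | set bs \<subseteq> Basis \<and> length bs \<le> N.
        (SUP x. (1 + norm x) ^ N * norm (iter_partial bs f x)))"

text \<open>
  A distribution is encoded as a functional on all functions of which only the values at
  Schwartz functions matter. The seminorms above increase with \<open>N\<close> and generate the
  topology of the Schwartz space, so the estimate below is continuity.
\<close>

type_synonym 'a distr = "('a \<Rightarrow> complex) \<Rightarrow> complex"

definition tempered :: "'a::euclidean_space distr \<Rightarrow> bool" where
  "tempered u \<longleftrightarrow>
     (\<forall>\<phi> \<rho>. schwartz \<phi> \<longrightarrow> schwartz \<rho> \<longrightarrow> u (\<lambda>x. \<phi> x + \<rho> x) = u \<phi> + u \<rho>) \<and>
     (\<forall>c \<phi>. schwartz \<phi> \<longrightarrow> u (\<lambda>x. c * \<phi> x) = c * u \<phi>) \<and>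
     (\<exists>C N. \<forall>\<phi>. schwartz \<phi> \<longrightarrow> norm (u \<phi>) \<le> C * schwartz_seminorm N \<phi>)"

definition represents :: "('a::euclidean_space \<Rightarrow> complex) \<Rightarrow> 'a distr \<Rightarrow> bool" where
  "represents g u \<longleftrightarrow> g \<in> borel_measurable lborel \<and>
     (\<forall>\<phi>. schwartz \<phi> \<longrightarrow>
        integrable lborel (\<lambda>x. g x * \<phi> x) \<and> u \<phi> = (LINT x|lborel. g x * \<phi> x))"


section \<open>Fourier transform\<close>

definition fourier :: "('a::euclidean_space \<Rightarrow> complex) \<Rightarrow> 'a \<Rightarrow> complex" where
  "fourier \<phi> \<xi> = of_real ((2 * pi) powr (- real DIM('a) / 2)) *
     (LINT x|lborel. cis (- (x \<bullet> \<xi>)) * \<phi> x)"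

definition inv_fourier :: "('a::euclidean_space \<Rightarrow> complex) \<Rightarrow> 'a \<Rightarrow> complex" where
  "inv_fourier \<phi> x = of_real ((2 * pi) powr (- real DIM('a) / 2)) *
     (LINT \<xi>|lborel. cis (x \<bullet> \<xi>) * \<phi> \<xi>)"

definition fourier_distr :: "'a::euclidean_space distr \<Rightarrow> 'a distr" where
  "fourier_distr u = (\<lambda>\<phi>. u (fourier \<phi>))"

definition inv_fourier_distr :: "'a::euclidean_space distr \<Rightarrow> 'a distr" where
  "inv_fourier_distr u = (\<lambda>\<phi>. u (inv_fourier \<phi>))"

definition mult_distr :: "('a::euclidean_space \<Rightarrow> real) \<Rightarrow> 'a distr \<Rightarrow> 'a distr" where
  "mult_distr \<psi> u = (\<lambda>\<phi>. u (\<lambda>\<xi>. of_real (\<psi> \<xi>) * \<phi> \<xi>))"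


section \<open>Frequency-uniform decomposition\<close>

definition int_lattice :: "'a::euclidean_space set" where
  "int_lattice = {k. \<forall>b\<in>Basis. k \<bullet> b \<in> \<int>}"

definition psi :: "(real \<Rightarrow> real) \<Rightarrow> 'a::euclidean_space \<Rightarrow> 'a \<Rightarrow> real" where
  "psi \<eta> k \<xi> = (\<Prod>b\<in>Basis. \<eta> (2 * (\<xi> \<bullet> b - k \<bullet> b))) /
     (\<Sum>\<^sub>\<infinity>m\<in>int_lattice. \<Prod>b\<in>Basis. \<eta> (2 * (\<xi> \<bullet> b - m \<bullet> b)))"

definition box_op :: "(real \<Rightarrow> real) \<Rightarrow> 'a::euclidean_space \<Rightarrow> 'a distr \<Rightarrow> 'a distr" where
  "box_op \<eta> k f = inv_fourier_distr (mult_distr (psi \<eta> k) (fourier_distr f))"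


section \<open>Norms with values in the extended nonnegative reals\<close>

text \<open>Only used with positive exponents, for which \<open>0 powr s = 0\<close>.\<close>

definition enn_powr :: "ennreal \<Rightarrow> real \<Rightarrow> ennreal" where
  "enn_powr x s = (if x = \<infinity> then \<infinity> else ennreal (enn2real x powr s))"

definition Lp_norm :: "ennreal \<Rightarrow> ('a::euclidean_space \<Rightarrow> complex) \<Rightarrow> ennreal" where
  "Lp_norm p g =
     (if p = \<infinity> then esssup lborel (\<lambda>x. ennreal (norm (g x)))
      else enn_powr (\<integral>\<^sup>+x. ennreal (norm (g x) powr enn2real p) \<partial>lborel) (1 / enn2real p))"

text \<open>
  The representing function of a distribution is unique up to null sets, so the infimum below is
  over a single value; it is \<open>\<infinity>\<close> if the distribution is not a function.
\<close>

definition Lp_norm_distr :: "ennreal \<Rightarrow> 'a::euclidean_space distr \<Rightarrow> ennreal" where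
  "Lp_norm_distr p u = (INF g\<in>{g. represents g u}. Lp_norm p g)"

definition lq_norm :: "ennreal \<Rightarrow> 'k set \<Rightarrow> ('k \<Rightarrow> ennreal) \<Rightarrow> ennreal" where
  "lq_norm q A a =
     (if q = \<infinity> then (SUP k\<in>A. a k)
      else enn_powr (\<Sum>\<^sub>\<infinity>k\<in>A. enn_powr (a k) (enn2real q)) (1 / enn2real q))"


section \<open>Modulation spaces\<close>

definition mod_norm ::
    "(real \<Rightarrow> real) \<Rightarrow> ennreal \<Rightarrow> ennreal \<Rightarrow> 'a::euclidean_space distr \<Rightarrow> ennreal" where
  "mod_norm \<eta> p q f = lq_norm q int_lattice (\<lambda>k. Lp_norm_distr p (box_op \<eta> k f))"

definition mod_space ::
    "(real \<Rightarrow> real) \<Rightarrow> ennreal \<Rightarrow> ennreal \<Rightarrow> 'a::euclidean_space distr set" where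
  "mod_space \<eta> p q = {f. tempered f \<and> mod_norm \<eta> p q f < \<infinity>}"

text \<open>
  The anisotropic space lives on \<open>'a \<times> real\<close>, the second component being the last coordinate.
\<close>

definition amod_norm ::
    "(real \<Rightarrow> real) \<Rightarrow> ennreal \<Rightarrow> ennreal \<Rightarrow> ennreal \<Rightarrow> ('a::euclidean_space \<times> real) distr \<Rightarrow> ennreal"
  where
  "amod_norm \<eta> p q r f =
     lq_norm r \<int> (\<lambda>kn. lq_norm q int_lattice (\<lambda>k. Lp_norm_distr p (box_op \<eta> (k, kn) f)))"

definition amod_space ::
    "(real \<Rightarrow> real) \<Rightarrow> ennreal \<Rightarrow> ennreal \<Rightarrow> ennreal \<Rightarrow> ('a::euclidean_space \<times> real) distr set"
  where
  "amod_space \<eta> p q r = {f. tempered f \<and> amod_norm \<eta> p q r f < \<infinity>}"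


section \<open>Trace\<close>

text \<open>
  For tempered \<open>f\<close>, each \<open>box_op \<eta> k f\<close> has compact Fourier support and hence is a smooth function
  of polynomial growth; \<open>cont_rep\<close> picks this function, whose values at \<open>(x, 0)\<close> are meaningful.
\<close>

definition cont_rep :: "'a::euclidean_space distr \<Rightarrow> 'a \<Rightarrow> complex" where
  "cont_rep u = (THE g. continuous_on UNIV g \<and> represents g u)"

text \<open>
  \<open>has_trace \<eta> f g\<close>: the trace of \<open>f\<close> on the hyperplane \<open>snd = 0\<close> is defined and is the tempered
  distribution \<open>g\<close>. The series over the lattice is an unordered sum, converging weakly.
\<close>

definition has_trace ::
    "(real \<Rightarrow> real) \<Rightarrow> ('a::euclidean_space \<times> real) distr \<Rightarrow> 'a distr \<Rightarrow> bool" where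
  "has_trace \<eta> f g \<longleftrightarrow> tempered g \<and>
     (if \<exists>h. schwartz h \<and> represents h f
      then \<exists>h. schwartz h \<and> represents h f \<and> represents (\<lambda>x. h (x, 0)) g
      else \<forall>\<phi>. schwartz \<phi> \<longrightarrow>
        ((\<lambda>k. LINT x|lborel. cont_rep (box_op \<eta> k f) (x, 0) * \<phi> x) has_sum g \<phi>) int_lattice)"

end

(*
  Let w be a Schwartz function on the line whose Fourier transform is supported near 0. Test the
  trace on f(x) = w(x_1) ... w(x_{n-1}) v(x_n), where v is the sum of N copies of w modulated to
  frequencies at distance three. Each k_n sees at most one copy, so that ||f|| is of order
  N^(1/r), whereas v(0) = N w(0) makes the trace of norm N. As 1/r < 1, no constant works.
  The transform of w is chosen to contain the denominator of psi_k as a factor, so that all pieces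
  Box_k f are tensor products of inverse transforms of explicit test functions.
*)

theory Submission
  imports Defs "HOL-Probability.Characteristic_Functions" "HOL-Probability.Sinc_Integral"
begin

section \<open>Smooth functions of one variable with compact support\<close>

text \<open>The denominator of \<open>psi\<close> is the obstacle. A block lets the distribution act
  on the transform of \<open>psi\<close> times an inverse transform; to see that this product is a
  Schwartz function one would have to differentiate the quotient. For distributions given by
  integrable functions the transform can be moved by Fubini instead, which asks for integrability
  only. Once the denominator is cancelled on the frequency side, inversion is needed only for smooth
  compactly supported functions of one variable. The numbers come from supports. In one coordinate
  the window of \<open>psi\<close> has radius 1 and a tooth \<open>\<eta> (4 * t)\<close> has radius
  1/2, so they meet only if their centres are less than 3/2 apart, and open intervals of radius 3/2
  around the multiples of three are disjoint. All frequency profiles are nonnegative, hence nothing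
  cancels in v(0) or in the pairings that bound the trace from below. The norm of a distribution is
  an infimum over its representing functions: an upper bound exhibits one of them, a lower bound
  tests all of them against one fixed Schwartz function.\<close>

fun C_k :: "nat \<Rightarrow> (real \<Rightarrow> complex) \<Rightarrow> bool" where
  "C_k 0 f = continuous_on UNIV f"
| "C_k (Suc n) f = (\<exists>f'. (\<forall>t. (f has_vector_derivative f' t) (at t)) \<and> C_k n f')"

lemma C_k_Suc_imp: "C_k (Suc n) f \<Longrightarrow> C_k n f"
proof (induction n arbitrary: f)
  case 0
  then show ?case
    by (metis C_k.simps continuous_at_imp_continuous_on has_vector_derivative_continuous)
next
  case (Suc n)
  then show ?case by (metis C_k.simps(2))
qed

lemma C_k_add: "C_k n f \<Longrightarrow> C_k n g \<Longrightarrow> C_k n (\<lambda>t. f t + g t)"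
proof (induction n arbitrary: f g)
  case 0
  then show ?case by (simp add: continuous_on_add continuous_on_mult)
next
  case (Suc n)
  then obtain f' g' where "\<forall>t. (f has_vector_derivative f' t) (at t)" "C_k n f'"
    "\<forall>t. (g has_vector_derivative g' t) (at t)" "C_k n g'" by auto
  then show ?case
    unfolding C_k.simps
    by (intro exI[of _ "\<lambda>t. f' t + g' t"] conjI allI has_vector_derivative_add Suc.IH) auto
qed

lemma C_k_mult: "C_k n f \<Longrightarrow> C_k n g \<Longrightarrow> C_k n (\<lambda>t. f t * g t)"
proof (induction n arbitrary: f g)
  case 0
  then show ?case by (simp add: continuous_on_add continuous_on_mult)
next
  case (Suc n)
  then obtain f' g' where *: "\<forall>t. (f has_vector_derivative f' t) (at t)" "C_k n f'"
    "\<forall>t. (g has_vector_derivative g' t) (at t)" "C_k n g'" by auto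
  have "C_k n f" "C_k n g" using Suc.prems C_k_Suc_imp by auto
  then have "C_k n (\<lambda>t. f t * g' t + f' t * g t)"
    using * Suc.IH C_k_add by auto
  then show ?case
    unfolding C_k.simps using *
    by (intro exI[of _ "\<lambda>t. f t * g' t + f' t * g t"] conjI allI has_vector_derivative_mult) auto
qed

lemma C_k_const: "C_k n (\<lambda>t. c)"
proof (induction n arbitrary: c)
  case (Suc n)
  then show ?case
    unfolding C_k.simps by (intro exI[of _ "\<lambda>_. 0"] conjI allI has_vector_derivative_const)
qed simp

lemma C_k_of_real: "C_k n of_real"
proof (cases n)
  case (Suc m)
  have "((of_real :: real \<Rightarrow> complex) has_vector_derivative 1) (at t)" for t
    by (rule has_vector_derivative_eq_rhs[OF has_vector_derivative_of_real]) (auto intro: derivative_intros)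
  then show ?thesis
    unfolding Suc C_k.simps using C_k_const by (intro exI[of _ "\<lambda>_. 1"] conjI allI)
qed (auto intro: continuous_intros)

lemma C_k_affine: "C_k n f \<Longrightarrow> C_k n (\<lambda>t. f (a * t + b))"
proof (induction n arbitrary: f)
  case 0
  then have "continuous_on UNIV f" by simp
  then have "continuous_on UNIV (\<lambda>t. f (a * t + b))"
    by (rule continuous_on_compose2) (auto intro: continuous_intros)
  then show ?case by simp
next
  case (Suc n)
  then obtain f' where f': "\<And>t. (f has_vector_derivative f' t) (at t)" "C_k n f'" by auto
  have "((\<lambda>t. f (a * t + b)) has_vector_derivative of_real a * f' (a * t + b)) (at t)" for t
  proof -
    have "((\<lambda>t. a * t + b) has_vector_derivative a) (at t)"
      by (auto intro!: derivative_eq_intros)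
    from vector_diff_chain_at[OF this f'(1)] show ?thesis
      by (simp add: o_def scaleR_conv_of_real)
  qed
  moreover have "C_k n (\<lambda>t. of_real a * f' (a * t + b))"
    by (intro C_k_mult C_k_const Suc.IH f'(2))
  ultimately show ?case
    unfolding C_k.simps by (intro exI[of _ "\<lambda>t. of_real a * f' (a * t + b)"] conjI allI)
qed

text \<open>The basis of the line is {1}, so the iterated partial derivatives along
  \<open>replicate m 1\<close> are the successive ordinary derivatives. They supply the witnesses
  that \<open>C_k\<close> asks for.\<close>

lemma smooth_imp_C_k:
  fixes \<eta> :: "real \<Rightarrow> real"
  assumes "smooth \<eta>"
  shows "C_k n (\<lambda>t. of_real (\<eta> t))"
proof -
  have d: "(iter_partial (replicate m 1) \<eta> has_vector_derivative
      iter_partial (replicate (Suc m) 1) \<eta> t) (at t)" for m t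
  proof -
    let ?f = "iter_partial (replicate m 1) \<eta>"
    have f: "?f differentiable (at t)"
      using assms unfolding smooth_def by (auto simp: set_replicate_conv_if)
    then have "(?f has_derivative frechet_derivative ?f (at t)) (at t)"
      by (simp add: frechet_derivative_works)
    \<comment> \<open>A linear map on the line is determined by its value at 1, which turns the
      Frechet derivative into a vector derivative.\<close>
    moreover have "frechet_derivative ?f (at t) = (\<lambda>h. h *\<^sub>R frechet_derivative ?f (at t) 1)"
    proof
      show "frechet_derivative ?f (at t) h = h *\<^sub>R frechet_derivative ?f (at t) 1" for h
        using linear_cmul[OF linear_frechet_derivative[OF f], of h 1]
        unfolding real_scaleR_def mult_1_right .
    qed
    ultimately have "(?f has_derivative (\<lambda>h. h *\<^sub>R frechet_derivative ?f (at t) 1)) (at t)"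
      by (rule back_subst)
    then show ?thesis unfolding has_vector_derivative_def iter_partial.simps replicate_Suc .
  qed
  have "C_k n (\<lambda>t. of_real (iter_partial (replicate m 1) \<eta> t))" for m
  proof (induction n arbitrary: m)
    case 0
    have "continuous_on UNIV (iter_partial (replicate m 1) \<eta>)"
      using d[of m] has_vector_derivative_continuous by (blast intro: continuous_at_imp_continuous_on)
    then show ?case by (simp add: continuous_on_of_real)
  next
    case (Suc n)
    then show ?case
      unfolding C_k.simps
      by (intro exI[of _ "\<lambda>t. of_real (iter_partial (replicate (Suc m) 1) \<eta> t)"] conjI allI
        has_vector_derivative_of_real d Suc.IH)
        (rule d[folded has_real_derivative_iff_has_vector_derivative])
  qed
  from this[of 0] show ?thesis by simp
qed

text \<open>The test functions of the line. Smoothness is stated through \<open>C_k\<close>, whose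
  existential derivatives make the closure rules short inductions without any explicit formula for
  higher derivatives.\<close>

definition bump :: "(real \<Rightarrow> complex) \<Rightarrow> bool" where
  "bump f \<longleftrightarrow> (\<forall>n. C_k n f) \<and> (\<exists>R. \<forall>t. R < \<bar>t\<bar> \<longrightarrow> f t = 0)"

text \<open>For each n the condition \<open>C_k (Suc n)\<close> may name another derivative;
  uniqueness of derivatives identifies them all. The support does not grow, since f vanishes on an
  open set outside [-R, R].\<close>

lemma bump_deriv:
  assumes "bump f"
  obtains f' where "bump f'" "\<And>t. (f has_vector_derivative f' t) (at t)"
proof -
  from assms obtain R where R: "\<And>t. R < \<bar>t\<bar> \<Longrightarrow> f t = 0" and C: "\<And>n. C_k n f"
    unfolding bump_def by blast
  obtain f' where "\<forall>t. (f has_vector_derivative f' t) (at t)"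
    using C[of "Suc 0"] unfolding C_k.simps by blast
  then have d: "(f has_vector_derivative f' t) (at t)" for t by simp
  have "C_k n f'" for n
  proof -
    obtain g where g: "\<forall>t. (f has_vector_derivative g t) (at t)" "C_k n g"
      using C[of "Suc n"] unfolding C_k.simps by blast
    have "g = f'"
      by (rule ext) (rule vector_derivative_unique_at[OF spec[OF g(1)] d])
    then show ?thesis using g by simp
  qed
  moreover have "f' t = 0" if t: "R < \<bar>t\<bar>" for t
  proof -
    have "open {t. R < \<bar>t\<bar>}" by (intro open_Collect_less continuous_intros)
    have "(f has_vector_derivative 0) (at t)"
      by (rule has_vector_derivative_transform_within_open[OF has_vector_derivative_const[of 0] \<open>open _\<close>])
        (simp_all add: R t)
    from vector_derivative_unique_at[OF d this] show ?thesis .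
  qed
  ultimately have "bump f'" unfolding bump_def by meson
  from that[OF this d] show thesis .
qed

text \<open>Asymmetric on purpose: the first factor may lack compact support, as characters and
  polynomials do.\<close>

lemma bump_mult: "(\<And>n. C_k n g) \<Longrightarrow> bump f \<Longrightarrow> bump (\<lambda>t. g t * f t)"
  unfolding bump_def by (metis C_k_mult mult_zero_right)

lemma bump_add:
  assumes "bump f" "bump g" shows "bump (\<lambda>t. f t + g t)"
proof -
  from assms obtain R S where "\<And>t. R < \<bar>t\<bar> \<Longrightarrow> f t = 0" "\<And>t. S < \<bar>t\<bar> \<Longrightarrow> g t = 0"
    unfolding bump_def by blast
  then have "\<forall>t. max R S < \<bar>t\<bar> \<longrightarrow> f t + g t = 0" by auto
  moreover have "\<forall>n. C_k n (\<lambda>t. f t + g t)" using assms C_k_add unfolding bump_def by blast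
  ultimately show ?thesis unfolding bump_def by blast
qed

lemma bump_sum: "(\<And>i. i \<in> I \<Longrightarrow> bump (f i)) \<Longrightarrow> bump (\<lambda>t. \<Sum>i\<in>I. f i t)"
proof (induction I rule: infinite_finite_induct)
  case (insert x F)
  then have "bump (\<lambda>t. f x t + (\<Sum>i\<in>F. f i t))" by (intro bump_add) auto
  then show ?case using insert by simp
qed (auto simp: bump_def C_k_const)

lemma bump_affine:
  assumes "bump f" "a \<noteq> 0"
  shows "bump (\<lambda>t. f (a * t + b))"
proof -
  from assms obtain R where R: "\<And>t. R < \<bar>t\<bar> \<Longrightarrow> f t = 0"
    unfolding bump_def by blast
  have "f (a * t + b) = 0" if "(R + \<bar>b\<bar>) / \<bar>a\<bar> < \<bar>t\<bar>" for t
  proof (rule R)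
    have "R + \<bar>b\<bar> < \<bar>a * t\<bar>" using that assms(2) by (simp add: field_simps abs_mult)
    then show "R < \<bar>a * t + b\<bar>" by linarith
  qed
  moreover have "\<forall>n. C_k n (\<lambda>t. f (a * t + b))"
    using assms(1) unfolding bump_def by (intro allI C_k_affine) simp
  ultimately show ?thesis unfolding bump_def by blast
qed

lemma bump_continuous: "bump f \<Longrightarrow> continuous_on UNIV f"
  unfolding bump_def by (metis C_k.simps(1))

lemma bump_support:
  assumes "bump f"
  obtains R where "R > 0" "\<And>t. t \<notin> {-R..R} \<Longrightarrow> f t = 0"
proof -
  from assms obtain R where R: "\<And>t. R < \<bar>t\<bar> \<Longrightarrow> f t = 0"
    unfolding bump_def by blast
  show thesis
    by (rule that[of "max R 1"]) (auto intro!: R)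
qed

lemma bump_integrable:
  assumes "bump f"
  shows "integrable lborel f"
proof -
  obtain R where R: "R > 0" "\<And>t. t \<notin> {-R..R} \<Longrightarrow> f t = 0"
    using bump_support[OF assms] by blast
  have "set_integrable lborel {-R..R} f"
    by (intro borel_integrable_atLeastAtMost' continuous_on_subset[OF bump_continuous[OF assms]]) auto
  moreover have "(\<lambda>t. indicat_real {-R..R} t *\<^sub>R f t) = f"
    using R by (auto simp: indicator_def)
  ultimately show ?thesis by (simp add: set_integrable_def)
qed

lemma bump_integral:
  assumes "bump f" "\<And>t. t \<notin> {-R..R} \<Longrightarrow> f t = 0"
  shows "(LINT t|lborel. f t) = integral {-R..R} f"
proof -
  have eq: "(\<lambda>t. indicat_real {-R..R} t *\<^sub>R f t) = f"
    using assms by (auto simp: indicator_def)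
  have "set_integrable lborel {-R..R} f"
    using bump_integrable[OF assms(1)] by (simp add: set_integrable_def eq)
  from set_borel_integral_eq_integral(2)[OF this] show ?thesis
    by (simp add: set_lebesgue_integral_def eq)
qed

lemma integral_bump_deriv:
  assumes "bump f" "bump f'" "\<And>t. (f has_vector_derivative f' t) (at t)"
  shows "(LINT t|lborel. f' t) = 0"
proof -
  obtain R where R: "R > 0" "\<And>t. t \<notin> {-R..R} \<Longrightarrow> f t = 0"
    using bump_support[OF assms(1)] by blast
  obtain S where S: "S > 0" "\<And>t. t \<notin> {-S..S} \<Longrightarrow> f' t = 0"
    using bump_support[OF assms(2)] by blast
  \<comment> \<open>The extra 1 puts both endpoints strictly outside the intervals where f and its
    derivative may be nonzero.\<close>
  define T where "T = max R S + 1"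
  have T: "R < T" "S < T" by (auto simp: T_def)
  have "f' t = 0" if "t \<notin> {-T..T}" for t
    by (rule S(2)) (use that T(2) in auto)
  then have "(LINT t|lborel. f' t) = integral {-T..T} f'"
    by (rule bump_integral[OF assms(2)])
  also have "\<dots> = f T - f (-T)"
    by (rule integral_unique, rule fundamental_theorem_of_calculus)
      (use R(1) T(1) has_vector_derivative_at_within[OF assms(3)] in simp_all)
  also have "\<dots> = 0"
  proof -
    have "f T = 0" "f (-T) = 0" by (rule R(2), use T(1) R(1) in simp)+
    then show ?thesis by simp
  qed
  finally show ?thesis .
qed

section \<open>The Fourier transform on the Schwartz space of the line\<close>

lemma cis_measurable [measurable]: "cis \<in> borel_measurable borel"
  by (intro borel_measurable_continuous_onI continuous_intros)

text \<open>A unimodular kernel leaves the majorant |a(t)| |b(x)|, which is integrable on the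
  product, so Fubini applies. The kernel is abstract in order to serve both signs of the
  exponent.\<close>

lemma integral_kernel_swap:
  fixes a b :: "'a::euclidean_space \<Rightarrow> complex"
  assumes a: "integrable lborel a" and b: "integrable lborel b"
    and k[measurable]: "(\<lambda>(x, t). k x t) \<in> borel_measurable (lborel \<Otimes>\<^sub>M lborel)"
    and 1: "\<And>x t. norm (k x t) = 1"
  shows "(LINT x|lborel. (LINT t|lborel. k x t * a t) * b x) =
         (LINT t|lborel. a t * (LINT x|lborel. k x t * b x))"
proof -
  have [measurable]: "a \<in> borel_measurable lborel" "b \<in> borel_measurable lborel"
    using a b by auto
  have k2[measurable]: "k x \<in> borel_measurable lborel" for x
    using measurable_compose_Pair1[OF _ k, of x] by simp
  have ka: "integrable lborel (\<lambda>t. k x t * a t)" for x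
    by (rule Bochner_Integration.integrable_bound[OF a]) (auto simp: norm_mult 1)
  have "integrable (lborel \<Otimes>\<^sub>M lborel) (\<lambda>(x, t). k x t * a t * b x)"
  proof (rule lborel_pair.Fubini_integrable)
    show "(\<lambda>(x, t). k x t * a t * b x) \<in> borel_measurable (lborel \<Otimes>\<^sub>M lborel)"
      by measurable
    show "integrable lborel (\<lambda>x. LINT t|lborel. norm (case (x, t) of (x, t) \<Rightarrow> k x t * a t * b x))"
      using b by (simp add: norm_mult 1)
    show "AE x in lborel. integrable lborel (\<lambda>t. case (x, t) of (x, t) \<Rightarrow> k x t * a t * b x)"
      using ka by simp
  qed
  from lborel_pair.Fubini_integral[OF this]
  show ?thesis by (simp add: mult_ac flip: integral_mult_left_zero integral_mult_right_zero)
qed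

text \<open>The form in which transforms are moved between factors throughout. As only integrability
  is demanded, it also applies to products with \<open>psi\<close>, whose smoothness is never
  examined.\<close>

lemma integral_fourier_mult:
  fixes a b :: "'a::euclidean_space \<Rightarrow> complex"
  assumes "integrable lborel a" "integrable lborel b"
  shows "(LINT x|lborel. fourier a x * b x) = (LINT x|lborel. a x * fourier b x)"
proof -
  have "(LINT x|lborel. (LINT t|lborel. cis (- (t \<bullet> x)) * a t) * b x) =
      (LINT t|lborel. a t * (LINT x|lborel. cis (- (x \<bullet> t)) * b x))"
    by (subst integral_kernel_swap[OF assms]) (simp_all add: inner_commute)
  moreover define c :: complex where "c = of_real ((2 * pi) powr (- real DIM('a) / 2))"
  ultimately show ?thesis
    unfolding fourier_def c_def[symmetric] mult.assoc mult.left_commute[of _ c] integral_mult_right_zero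
    by simp
qed

lemma inv_fourier_eq_fourier_minus: "inv_fourier f x = fourier f (- x)"
  by (simp add: fourier_def inv_fourier_def inner_commute)

lemma integral_inv_fourier_mult:
  fixes a b :: "'a::euclidean_space \<Rightarrow> complex"
  assumes "integrable lborel a" "integrable lborel b"
  shows "(LINT x|lborel. inv_fourier a x * b x) = (LINT x|lborel. a x * inv_fourier b x)"
proof -
  have "(LINT x|lborel. (LINT t|lborel. cis (x \<bullet> t) * a t) * b x) =
      (LINT t|lborel. a t * (LINT x|lborel. cis (t \<bullet> x) * b x))"
    by (subst integral_kernel_swap[OF assms]) (simp_all add: inner_commute)
  moreover define c :: complex where "c = of_real ((2 * pi) powr (- real DIM('a) / 2))"
  ultimately show ?thesis
    unfolding inv_fourier_def c_def[symmetric] mult.assoc mult.left_commute[of _ c] integral_mult_right_zero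
    by simp
qed

lemma inv_fourier_measurable [measurable]:
  assumes [measurable]: "f \<in> borel_measurable lborel"
  shows "inv_fourier f \<in> borel_measurable lborel"
  unfolding inv_fourier_def by measurable

lemma integrable_cis_mult:
  assumes "integrable lborel f" and [measurable]: "g \<in> borel_measurable lborel"
  shows "integrable lborel (\<lambda>x. cis (g x) * f x)"
proof -
  have [measurable]: "f \<in> borel_measurable lborel" using assms by auto
  show ?thesis
    by (rule Bochner_Integration.integrable_bound[OF assms(1)]) (auto simp: norm_mult)
qed

lemma norm_fourier_le:
  fixes f :: "'a::euclidean_space \<Rightarrow> complex"
  assumes "integrable lborel f"
  shows "norm (fourier f \<xi>) \<le> (2 * pi) powr (- real DIM('a) / 2) * (LINT x|lborel. norm (f x))"
proof -
  have "norm (LINT x|lborel. cis (- (x \<bullet> \<xi>)) * f x) \<le> (LINT x|lborel. norm (cis (- (x \<bullet> \<xi>)) * f x))"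
    by (rule integral_norm_bound)
  also have "\<dots> = (LINT x|lborel. norm (f x))" by (simp add: norm_mult)
  finally show ?thesis by (simp add: fourier_def norm_mult mult_left_mono)
qed

lemma fourier_real:
  fixes f :: "real \<Rightarrow> complex"
  shows "fourier f x = of_real ((2 * pi) powr (- 1 / 2)) * (LINT t|lborel. cis (- x * t) * f t)"
  by (simp add: fourier_def mult.commute)

lemma inv_fourier_eq_fourier_reflect:
  fixes f :: "real \<Rightarrow> complex"
  shows "inv_fourier f = fourier (\<lambda>t. f (- t))"
proof
  fix x :: real
  show "inv_fourier f x = fourier (\<lambda>t. f (- t)) x"
    unfolding inv_fourier_def fourier_def
    by (subst lborel_integral_real_affine[where c="-1" and t=0]) (auto simp: mult.commute)
qed

section \<open>Derivatives and decay of transforms of bumps\<close>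

lemma has_vector_derivative_cis_mult:
  "((\<lambda>t. cis (a * t)) has_vector_derivative \<i> * of_real a * cis (a * t)) (at t)"
proof -
  have "((\<lambda>t. a * t) has_vector_derivative a) (at t)"
    by (auto intro!: derivative_eq_intros)
  from vector_diff_chain_at[OF this has_vector_derivative_iexp]
  show ?thesis by (simp add: o_def cis_conv_exp scaleR_conv_of_real mult_ac)
qed

lemma C_k_cis: "C_k n (\<lambda>t. cis (a * t))"
proof (induction n)
  case (Suc n)
  show ?case
    unfolding C_k.simps
    by (intro exI[of _ "\<lambda>t. \<i> * of_real a * cis (a * t)"] conjI allI has_vector_derivative_cis_mult
        C_k_mult C_k_const Suc)
qed (auto intro!: continuous_intros)

text \<open>Integration by parts, in the form that the derivative of the compactly supported
  function \<open>e t * f t\<close> has integral zero.\<close>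

lemma fourier_deriv:
  assumes f: "bump f" and f': "bump f'" and d: "\<And>t. (f has_vector_derivative f' t) (at t)"
  shows "fourier f' x = \<i> * of_real x * fourier f x"
proof -
  define e where "e t = cis (- x * t)" for t
  have e: "C_k n e" for n unfolding e_def by (rule C_k_cis)
  have b1: "bump (\<lambda>t. e t * f t)" and b2: "bump (\<lambda>t. e t * f' t)"
    by (intro bump_mult e f f')+
  have b3: "bump (\<lambda>t. - \<i> * of_real x * (e t * f t))"
    by (intro bump_mult C_k_const b1)
  have "(LINT t|lborel. e t * f' t + - \<i> * of_real x * (e t * f t)) = 0"
  proof (rule integral_bump_deriv[OF b1 bump_add[OF b2 b3]])
    fix t
    have "(e has_vector_derivative \<i> * of_real (- x) * e t) (at t)"
      unfolding e_def by (rule has_vector_derivative_cis_mult)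
    from has_vector_derivative_mult[OF this d[of t]]
    show "((\<lambda>t. e t * f t) has_vector_derivative e t * f' t + - \<i> * of_real x * (e t * f t)) (at t)"
      by (simp add: mult_ac)
  qed
  moreover have "(LINT t|lborel. e t * f' t + - \<i> * of_real x * (e t * f t)) =
      (LINT t|lborel. e t * f' t) + - \<i> * of_real x * (LINT t|lborel. e t * f t)"
    by (simp only: Bochner_Integration.integral_add[OF bump_integrable[OF b2] bump_integrable[OF b3]]
        integral_mult_right_zero)
  ultimately have "(LINT t|lborel. e t * f' t) = \<i> * of_real x * (LINT t|lborel. e t * f t)"
    by (simp add: algebra_simps)
  then show ?thesis by (simp add: fourier_real e_def mult_ac)
qed

text \<open>Each factor |x| is paid for by one derivative of f, which is again a bump; what remains
  is the trivial sup bound by the L1 norm.\<close>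

lemma fourier_bump_power_decay:
  assumes "bump f"
  shows "\<exists>C. \<forall>x. \<bar>x\<bar> ^ n * norm (fourier f x) \<le> C"
  using assms
proof (induction n arbitrary: f)
  case 0
  show ?case using norm_fourier_le[OF bump_integrable[OF 0]] by auto
next
  case (Suc n)
  obtain f' where f': "bump f'" "\<And>t. (f has_vector_derivative f' t) (at t)"
    by (rule bump_deriv[OF Suc.prems]) blast
  from Suc.IH[OF f'(1)] fourier_deriv[OF Suc.prems f'] show ?case
    by (auto simp: norm_mult mult_ac)
qed

lemma fourier_bump_decay:
  assumes "bump f"
  shows "\<exists>C. \<forall>x. (1 + \<bar>x\<bar>) ^ n * norm (fourier f x) \<le> C"
proof -
  obtain A where A: "\<And>x. \<bar>x\<bar> ^ 0 * norm (fourier f x) \<le> A"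
    using fourier_bump_power_decay[OF assms] by blast
  obtain B where B: "\<And>x. \<bar>x\<bar> ^ n * norm (fourier f x) \<le> B"
    using fourier_bump_power_decay[OF assms] by blast
  have "(1 + \<bar>x\<bar>) ^ n * norm (fourier f x) \<le> 2 ^ n * (A + B)" for x
  proof -
    have "(1 + \<bar>x\<bar>) ^ n \<le> (2 * max 1 \<bar>x\<bar>) ^ n" by (intro power_mono) auto
    also have "\<dots> \<le> 2 ^ n * (1 + \<bar>x\<bar> ^ n)"
      by (auto simp: power_mult_distrib max_def)
    finally have "(1 + \<bar>x\<bar>) ^ n * norm (fourier f x) \<le> 2 ^ n * (1 + \<bar>x\<bar> ^ n) * norm (fourier f x)"
      by (rule mult_right_mono) simp
    also have "\<dots> = 2 ^ n * (\<bar>x\<bar> ^ 0 * norm (fourier f x) + \<bar>x\<bar> ^ n * norm (fourier f x))"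
      by (simp add: algebra_simps)
    also have "\<dots> \<le> 2 ^ n * (A + B)"
      using A[of x] B[of x] by (intro mult_left_mono add_mono) auto
    finally show ?thesis .
  qed
  then show ?thesis by blast
qed

text \<open>Compact support turns the transform into an integral over a fixed interval, where the
  Leibniz rule needs nothing beyond joint continuity of the differentiated integrand.\<close>

lemma has_vector_derivative_fourier:
  assumes f: "bump f"
  shows "(fourier f has_vector_derivative fourier (\<lambda>t. - \<i> * of_real t * f t) x) (at x)"
proof -
  obtain R where R: "R > 0" "\<And>t. t \<notin> {-R..R} \<Longrightarrow> f t = 0"
    using bump_support[OF f] by blast
  define c :: complex where "c = of_real ((2 * pi) powr (- 1 / 2))"
  let ?g = "\<lambda>t. - \<i> * of_real t * f t"
  have g: "bump ?g" by (intro bump_mult f C_k_mult C_k_const C_k_of_real)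
  have F: "fourier h x = c * integral {-R..R} (\<lambda>t. cis (- x * t) * h t)"
    if "bump h" "\<And>t. t \<notin> {-R..R} \<Longrightarrow> h t = 0" for h x
  proof -
    have "bump (\<lambda>t. cis (- x * t) * h t)" by (intro bump_mult C_k_cis that)
    from bump_integral[OF this, of R] that(2) show ?thesis
      by (simp add: fourier_real c_def)
  qed
  have "((\<lambda>x. integral (cbox (-R) R) (\<lambda>t. cis (- x * t) * f t)) has_vector_derivative
      integral (cbox (-R) R) (\<lambda>t. cis (- x * t) * ?g t)) (at x within UNIV)"
  proof (rule leibniz_rule_vector_derivative)
    fix x t :: real
    have "((\<lambda>x. cis (- t * x) * f t) has_vector_derivative (\<i> * of_real (- t) * cis (- t * x)) * f t) (at x)"
      by (intro has_vector_derivative_mult_left has_vector_derivative_cis_mult)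
    then show "((\<lambda>x. cis (- x * t) * f t) has_vector_derivative cis (- x * t) * ?g t) (at x within UNIV)"
      by (simp add: mult_ac)
  next
    fix x :: real
    have "continuous_on (cbox (-R) R) (\<lambda>t. cis (- x * t) * f t)"
      by (intro continuous_intros continuous_on_subset[OF bump_continuous[OF f]]) auto
    then show "(\<lambda>t. cis (- x * t) * f t) integrable_on cbox (-R) R"
      by (rule integrable_continuous)
  next
    have "continuous_on (UNIV \<times> cbox (-R) R) (\<lambda>p. f (snd p))"
      by (rule continuous_on_compose2[OF bump_continuous[OF f]]) (auto intro: continuous_intros)
    then show "continuous_on (UNIV \<times> cbox (-R) R) (\<lambda>(x, t). cis (- x * t) * ?g t)"
      unfolding split_beta by (intro continuous_intros)
  qed auto
  from has_vector_derivative_mult_right[OF this, of c]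
  have "((\<lambda>x. c * integral {-R..R} (\<lambda>t. cis (- x * t) * f t)) has_vector_derivative
      c * integral {-R..R} (\<lambda>t. cis (- x * t) * ?g t)) (at x)"
    unfolding cbox_interval .
  moreover have "fourier f = (\<lambda>x. c * integral {-R..R} (\<lambda>t. cis (- x * t) * f t))"
    using F[OF f R(2)] by blast
  moreover have "fourier ?g x = c * integral {-R..R} (\<lambda>t. cis (- x * t) * ?g t)"
    by (rule F[OF g]) (simp add: R(2))
  ultimately show ?thesis by simp
qed

text \<open>\<open>D n\<close> is the \<open>n\<close>-th derivative of the Schwartz function \<open>D 0\<close>.\<close>

definition schwartz_tower :: "(nat \<Rightarrow> real \<Rightarrow> complex) \<Rightarrow> bool" where
  "schwartz_tower D \<longleftrightarrow> (\<forall>n x. (D n has_vector_derivative D (Suc n) x) (at x)) \<and>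
     (\<forall>n N. \<exists>C. \<forall>x. (1 + \<bar>x\<bar>) ^ N * norm (D n x) \<le> C)"

text \<open>Differentiating a transform multiplies the original by -it, which keeps it a bump. Hence
  the whole tower consists of transforms of bumps, and the decay estimate holds at every
  level.\<close>

lemma fourier_bump_tower:
  assumes "bump f"
  obtains D where "schwartz_tower D" "D 0 = fourier f"
proof -
  define g where "g n t = (- \<i> * of_real t) ^ n * f t" for n t
  have g: "bump (g n)" for n
  proof (induction n)
    case (Suc n)
    have "bump (\<lambda>t. - \<i> * of_real t * g n t)"
      by (intro bump_mult Suc C_k_mult C_k_const C_k_of_real)
    then show ?case unfolding g_def by (simp add: mult_ac)
  qed (simp add: g_def assms)
  have "g (Suc n) = (\<lambda>t. - \<i> * of_real t * g n t)" for n
    by (simp add: g_def fun_eq_iff)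
  then have "schwartz_tower (\<lambda>n. fourier (g n))"
    unfolding schwartz_tower_def
    using has_vector_derivative_fourier[OF g] fourier_bump_decay[OF g] by simp
  moreover have "g 0 = f" by (simp add: g_def fun_eq_iff)
  ultimately show thesis using that[of "\<lambda>n. fourier (g n)"] by simp
qed

lemma inv_fourier_bump_tower:
  assumes "bump f"
  obtains D where "schwartz_tower D" "D 0 = inv_fourier f"
  using fourier_bump_tower[OF bump_affine[OF assms, of "-1" 0]]
  by (auto simp: inv_fourier_eq_fourier_reflect)

lemma integrable_inverse_square_UNIV: "integrable lborel (\<lambda>x::real. inverse (1 + x\<^sup>2))"
  using integrable_inverse_1_plus_square
  by (simp add: set_integrable_def)

lemma inverse_square_bound:
  fixes x y C :: real
  assumes "(1 + \<bar>x\<bar>) ^ 2 * y \<le> C"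
  shows "y \<le> \<bar>C\<bar> * inverse (1 + x\<^sup>2)"
proof -
  have "1 + x\<^sup>2 \<le> (1 + \<bar>x\<bar>) ^ 2" by (simp add: power2_eq_square algebra_simps)
  moreover have p: "0 < 1 + x\<^sup>2" by (simp add: add_pos_nonneg)
  ultimately have "(1 + x\<^sup>2) * y \<le> \<bar>C\<bar>"
    using assms mult_right_mono[of "1 + x\<^sup>2" "(1 + \<bar>x\<bar>) ^ 2" y]
    by (cases "y \<ge> 0") (auto simp: mult_nonneg_nonpos intro: order_trans[of _ 0])
  then show ?thesis using p by (simp add: field_simps)
qed

text \<open>The majorant 1 / (1 + x^2) is integrable and at most 1; products of it over the
  coordinates will serve for all exponents p at once.\<close>

lemma schwartz_tower_bound:
  assumes "schwartz_tower D"
  obtains C where "C \<ge> 0" "\<And>x. norm (D n x) \<le> C * inverse (1 + x\<^sup>2)"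
proof -
  obtain C where C: "\<And>x. (1 + \<bar>x\<bar>) ^ 2 * norm (D n x) \<le> C"
    using assms unfolding schwartz_tower_def by meson
  show thesis
    by (rule that[of "\<bar>C\<bar>"]) (simp_all add: inverse_square_bound[OF C])
qed

lemma schwartz_tower_continuous:
  assumes "schwartz_tower D"
  shows "continuous_on UNIV (D n)"
  using assms has_vector_derivative_continuous unfolding schwartz_tower_def
  by (blast intro: continuous_at_imp_continuous_on)

lemma schwartz_tower_integrable:
  assumes "schwartz_tower D"
  shows "integrable lborel (D n)"
proof -
  obtain C where C: "C \<ge> 0" "\<And>x. norm (D n x) \<le> C * inverse (1 + x\<^sup>2)"
    using schwartz_tower_bound[OF assms] by blast
  have [measurable]: "D n \<in> borel_measurable borel"
    by (intro borel_measurable_continuous_onI schwartz_tower_continuous assms)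
  have "integrable lborel (\<lambda>x. C * inverse (1 + x\<^sup>2))"
    by (intro integrable_mult_right integrable_inverse_square_UNIV)
  then show ?thesis
    by (rule Bochner_Integration.integrable_bound) (use C in \<open>auto intro!: AE_I2 simp: abs_mult\<close>)
qed

section \<open>Fourier inversion on the line\<close>

lemma integral_cis_gauss:
  "(LINT x|lborel. cis (a * x) * of_real (exp (- x\<^sup>2 / 2))) = of_real (sqrt (2 * pi) * exp (- a\<^sup>2 / 2))"
proof -
  \<comment> \<open>The integral is read off from the characteristic function of the standard normal
    distribution.\<close>
  have "char std_normal_distribution a =
      (LINT x|lborel. std_normal_density x *\<^sub>R iexp (a * x))"
    unfolding char_def by (subst integral_density) (auto simp: normal_density_nonneg)
  also have "\<dots> = (LINT x|lborel. of_real (1 / sqrt (2 * pi)) * (cis (a * x) * of_real (exp (- x\<^sup>2 / 2))))"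
    by (intro Bochner_Integration.integral_cong)
      (auto simp: std_normal_density_def scaleR_conv_of_real cis_conv_exp)
  also have "\<dots> = of_real (1 / sqrt (2 * pi)) * (LINT x|lborel. cis (a * x) * of_real (exp (- x\<^sup>2 / 2)))"
    by (rule integral_mult_right_zero)
  finally show ?thesis
    by (simp add: char_std_normal_distribution field_simps)
qed

lemma integrable_gauss: "integrable lborel (\<lambda>x::real. complex_of_real (exp (- x\<^sup>2 / 2)))"
proof -
  have "integrable lborel (\<lambda>x. sqrt (2 * pi) * std_normal_density x)"
    by (intro integrable_mult_right) (simp add: integrable_normal_density)
  then show ?thesis
    by (simp add: std_normal_density_def complex_of_real_integrable_eq)
qed

text \<open>Gaussian regularisation: pair \<open>fourier a\<close> with a modulated Gaussian of width \<open>1 / \<epsilon>\<close>,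
  whose transform is an approximate identity at \<open>- \<xi>\<close>.\<close>

lemma fourier_fourier:
  fixes a :: "real \<Rightarrow> complex"
  assumes a: "integrable lborel a" and cont: "continuous_on UNIV a" and bdd: "\<And>x. norm (a x) \<le> B"
    and Fa: "integrable lborel (fourier a)"
  shows "fourier (fourier a) \<xi> = a (- \<xi>)"
proof -
  define G where "G x = complex_of_real (exp (- x\<^sup>2 / 2))" for x
  define c :: complex where "c = of_real ((2 * pi) powr (- 1 / 2))"
  define E where "E n = 1 / real (Suc n)" for n
  have E0: "E n > 0" for n by (simp add: E_def)
  have Elim: "E \<longlonglongrightarrow> 0"
    unfolding E_def using LIMSEQ_inverse_real_of_nat by (simp add: inverse_eq_divide)
  have cc: "c * of_real (sqrt (2 * pi)) = 1"
    unfolding c_def by (simp add: powr_minus powr_half_sqrt flip: of_real_mult)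
  have G: "integrable lborel G" unfolding G_def by (rule integrable_gauss)
  have [measurable]: "G \<in> borel_measurable borel" "a \<in> borel_measurable borel"
    "fourier a \<in> borel_measurable borel"
    using G a Fa by auto
  have GE: "integrable lborel (\<lambda>x. G (e * x))" if "e \<noteq> 0" for e
    using lborel_integrable_real_affine[OF G that, of 0] by simp
  define b where "b e x = cis (- \<xi> * x) * G (e * x)" for e x
  have b: "integrable lborel (b e)" if "e \<noteq> 0" for e
    unfolding b_def using GE[OF that] by (rule integrable_cis_mult) simp
  have Fb: "fourier (b e) t = of_real (1 / e) * G ((t + \<xi>) / e)" if e: "e > 0" for e t
  proof -
    have "(LINT x|lborel. cis (- (t + \<xi>) * x) * G (e * x)) =
        \<bar>1 / e\<bar> *\<^sub>R (LINT x|lborel. cis (- (t + \<xi>) * (0 + 1 / e * x)) * G (e * (0 + 1 / e * x)))"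
      using e by (intro lborel_integral_real_affine) auto
    also have "\<dots> = of_real (1 / e) * (LINT x|lborel. cis (- (t + \<xi>) / e * x) * G x)"
      using e by (simp add: scaleR_conv_of_real)
    also have "(LINT x|lborel. cis (- (t + \<xi>) / e * x) * G x) = of_real (sqrt (2 * pi)) * G ((t + \<xi>) / e)"
      unfolding G_def by (subst integral_cis_gauss) (simp add: power_divide power2_eq_square algebra_simps)
    finally have *: "(LINT x|lborel. cis (- (t + \<xi>) * x) * G (e * x)) =
        of_real (1 / e) * (of_real (sqrt (2 * pi)) * G ((t + \<xi>) / e))" .
    have "cis (- t * x) * b e x = cis (- (t + \<xi>) * x) * G (e * x)" for x
      unfolding b_def by (simp add: cis_mult algebra_simps flip: mult.assoc)
    then have "fourier (b e) t = c * (LINT x|lborel. cis (- (t + \<xi>) * x) * G (e * x))"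
      by (simp add: fourier_real c_def)
    also have "\<dots> = (c * of_real (sqrt (2 * pi))) * (of_real (1 / e) * G ((t + \<xi>) / e))"
      unfolding * by (simp add: mult_ac)
    finally show ?thesis by (simp add: cc)
  qed
  \<comment> \<open>The substitution t = -\<xi> + e s makes the Gaussian independent of e and moves
    the parameter into the argument of a, where continuity can act.\<close>
  have key: "(LINT x|lborel. fourier a x * b e x) = (LINT s|lborel. a (- \<xi> + e * s) * G s)" if e: "e > 0" for e
  proof -
    have "(LINT x|lborel. fourier a x * b e x) = (LINT t|lborel. a t * fourier (b e) t)"
      using a b e by (intro integral_fourier_mult) auto
    also have "\<dots> = (LINT t|lborel. a t * (of_real (1 / e) * G ((t + \<xi>) / e)))"
      using e by (simp add: Fb)
    also have "\<dots> = \<bar>e\<bar> *\<^sub>R (LINT s|lborel. a (- \<xi> + e * s) * (of_real (1 / e) * G ((- \<xi> + e * s + \<xi>) / e)))"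
      using e by (intro lborel_integral_real_affine) auto
    also have "\<dots> = (LINT s|lborel. e *\<^sub>R (a (- \<xi> + e * s) * (of_real (1 / e) * G ((- \<xi> + e * s + \<xi>) / e))))"
      using e by simp
    also have "\<dots> = (LINT s|lborel. a (- \<xi> + e * s) * G s)"
      using e by (intro Bochner_Integration.integral_cong) (auto simp: scaleR_conv_of_real)
    finally show ?thesis .
  qed
  have G1: "norm (G x) \<le> 1" for x by (simp add: G_def)
  have contG: "isCont G x" for x unfolding G_def by (intro continuous_intros) auto
  have conta: "isCont a x" for x using cont by (simp add: continuous_on_eq_continuous_at)
  \<comment> \<open>On this side the Gaussian is bounded by 1 and tends to 1, so the integrable
    function \<open>fourier a\<close> dominates.\<close>
  have "(\<lambda>n. LINT x|lborel. fourier a x * b (E n) x) \<longlonglongrightarrow> (LINT x|lborel. fourier a x * (cis (- \<xi> * x) * 1))"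
  proof (rule integral_dominated_convergence[where w="\<lambda>x. norm (fourier a x)"])
    show "AE x in lborel. (\<lambda>n. fourier a x * b (E n) x) \<longlonglongrightarrow> fourier a x * (cis (- \<xi> * x) * 1)"
    proof (rule AE_I2)
      fix x :: real
      have "(\<lambda>n. E n * x) \<longlonglongrightarrow> 0" using tendsto_mult_right[OF Elim, of x] by simp
      from isCont_tendsto_compose[OF contG this] have "(\<lambda>n. G (E n * x)) \<longlonglongrightarrow> 1"
        by (simp add: G_def)
      then show "(\<lambda>n. fourier a x * b (E n) x) \<longlonglongrightarrow> fourier a x * (cis (- \<xi> * x) * 1)"
        unfolding b_def by (intro tendsto_intros)
    qed
    show "AE x in lborel. norm (fourier a x * b (E n) x) \<le> norm (fourier a x)" for n
      using G1 by (auto simp: norm_mult b_def mult_left_le)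
  qed (use Fa in \<open>auto simp: b_def\<close>)
  moreover have "(\<lambda>n. LINT s|lborel. a (- \<xi> + E n * s) * G s) \<longlonglongrightarrow> (LINT s|lborel. a (- \<xi>) * G s)"
  proof (rule integral_dominated_convergence[where w="\<lambda>s. B * norm (G s)"])
    show "AE s in lborel. (\<lambda>n. a (- \<xi> + E n * s) * G s) \<longlonglongrightarrow> a (- \<xi>) * G s"
    proof (rule AE_I2)
      fix s :: real
      have "(\<lambda>n. - \<xi> + E n * s) \<longlonglongrightarrow> - \<xi> + 0 * s" by (intro tendsto_intros Elim)
      then have "(\<lambda>n. - \<xi> + E n * s) \<longlonglongrightarrow> - \<xi>" by simp
      from isCont_tendsto_compose[OF conta this]
      show "(\<lambda>n. a (- \<xi> + E n * s) * G s) \<longlonglongrightarrow> a (- \<xi>) * G s"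
        by (intro tendsto_intros)
    qed
    show "AE s in lborel. norm (a (- \<xi> + E n * s) * G s) \<le> B * norm (G s)" for n
      using bdd by (auto simp: norm_mult intro!: mult_right_mono)
  qed (use G in auto)
  ultimately have "(LINT x|lborel. fourier a x * (cis (- \<xi> * x) * 1)) = (LINT s|lborel. a (- \<xi>) * G s)"
    unfolding key[OF E0] by (rule LIMSEQ_unique)
  \<comment> \<open>The factor cis (0 * s) = 1 is inserted so that the Gaussian integral at
    frequency 0 can be quoted.\<close>
  also have "\<dots> = a (- \<xi>) * (LINT s|lborel. cis (0 * s) * G s)" by simp
  also have "(LINT s|lborel. cis (0 * s) * G s) = of_real (sqrt (2 * pi))"
    unfolding G_def by (subst integral_cis_gauss) simp
  finally have "fourier (fourier a) \<xi> = (c * of_real (sqrt (2 * pi))) * a (- \<xi>)"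
    by (simp add: fourier_real c_def mult_ac)
  then show ?thesis by (simp add: cc)
qed

lemma bump_bounded:
  assumes "bump f"
  obtains B where "\<And>x. norm (f x) \<le> B"
proof -
  obtain R where R: "R > 0" "\<And>t. t \<notin> {-R..R} \<Longrightarrow> f t = 0"
    using bump_support[OF assms] by blast
  have "compact (f ` {-R..R})"
    by (intro compact_continuous_image continuous_on_subset[OF bump_continuous[OF assms]]) auto
  then obtain B where B: "\<And>t. t \<in> {-R..R} \<Longrightarrow> norm (f t) \<le> B"
    by (meson bounded_iff compact_imp_bounded imageI)
  have "norm (f t) \<le> max B 0" for t
    using B[of t] R(2)[of t] by (cases "t \<in> {-R..R}") auto
  then show thesis by (rule that)
qed

lemma fourier_fourier_bump: "bump f \<Longrightarrow> fourier (fourier f) \<xi> = f (- \<xi>)"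
  by (metis bump_bounded bump_continuous bump_integrable fourier_bump_tower fourier_fourier
      schwartz_tower_integrable)

lemma inv_fourier_fourier_bump: "bump f \<Longrightarrow> inv_fourier (fourier f) \<xi> = f \<xi>"
  by (simp add: inv_fourier_eq_fourier_minus fourier_fourier_bump)

lemma fourier_inv_fourier_bump:
  assumes "bump f"
  shows "fourier (inv_fourier f) \<xi> = f \<xi>"
  using fourier_fourier_bump[OF bump_affine[OF assms, of "-1" 0], of \<xi>]
  by (simp add: inv_fourier_eq_fourier_reflect)

section \<open>Tensor products in Euclidean space\<close>

text \<open>The index of a factor is the basis vector itself, so one definition covers both the
  space and the hyperplane: on a product with the line, the last coordinate is the factor at (0,
  1).\<close>

definition tensor :: "('a::euclidean_space \<Rightarrow> real \<Rightarrow> complex) \<Rightarrow> 'a \<Rightarrow> complex" where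
  "tensor F x = (\<Prod>b\<in>Basis. F b (x \<bullet> b))"

lemma tensor_cong: "(\<And>b t. b \<in> Basis \<Longrightarrow> F b t = G b t) \<Longrightarrow> tensor F = tensor G"
  unfolding tensor_def by (intro ext prod.cong) auto

lemma tensor_mult: "tensor F x * tensor G x = tensor (\<lambda>b t. F b t * G b t) x"
  by (simp add: tensor_def prod.distrib)

text \<open>Lebesgue measure on the space is the image of a finite product of Lebesgue measures on
  the line under the coordinate map. After this change of variables both claims are Fubini for
  finite products.\<close>

lemma
  fixes F :: "'a::euclidean_space \<Rightarrow> real \<Rightarrow> complex"
  assumes F: "\<And>b. b \<in> Basis \<Longrightarrow> integrable lborel (F b)"
  shows integrable_tensor: "integrable lborel (tensor F)"
    and integral_tensor: "(LINT x|lborel. tensor F x) = (\<Prod>b\<in>Basis. LINT t|lborel. F b t)"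
proof -
  interpret product_sigma_finite "\<lambda>_::'a. lborel :: real measure" ..
  let ?g = "\<lambda>f :: 'a \<Rightarrow> real. \<Sum>b\<in>Basis. f b *\<^sub>R b"
  have [measurable]: "F b \<in> borel_measurable borel" if "b \<in> Basis" for b
    using F[OF that] by auto
  have g: "?g \<in> measurable (\<Pi>\<^sub>M b\<in>Basis. lborel) borel"
    by measurable
  have t: "tensor F \<in> borel_measurable borel" unfolding tensor_def by measurable
  have tg: "tensor F (?g f) = (\<Prod>b\<in>Basis. F b (f b))" for f
    unfolding tensor_def by (intro prod.cong) (auto simp: inner_sum_left_Basis)
  show "integrable lborel (tensor F)"
    unfolding lborel_eq[where 'a='a]
    by (subst integrable_distr_eq[OF g t]) (auto simp: tg F intro!: product_integrable_prod)
  show "(LINT x|lborel. tensor F x) = (\<Prod>b\<in>Basis. LINT t|lborel. F b t)"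
    unfolding lborel_eq[where 'a='a]
    by (subst integral_distr[OF g t]) (auto simp: tg F product_integral_prod simp flip: lborel_eq)
qed

lemma cis_sum: "finite A \<Longrightarrow> cis (\<Sum>a\<in>A. f a) = (\<Prod>a\<in>A. cis (f a))"
  by (induction rule: finite_induct) (auto simp flip: cis_mult)

text \<open>The character factors over the coordinates, and so does the normalising constant, since
  it is the DIM-th power of its one-dimensional value.\<close>

lemma fourier_tensor:
  fixes F :: "'a::euclidean_space \<Rightarrow> real \<Rightarrow> complex"
  assumes F: "\<And>b. b \<in> Basis \<Longrightarrow> integrable lborel (F b)"
  shows "fourier (tensor F) = tensor (\<lambda>b. fourier (F b))"
proof
  fix \<xi> :: 'a
  define c where "c = (2 * pi) powr (- 1 / 2)"
  have "cis (- (x \<bullet> \<xi>)) * tensor F x = tensor (\<lambda>b t. cis (- (\<xi> \<bullet> b) * t) * F b t) x" for x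
  proof -
    have "- (x \<bullet> \<xi>) = (\<Sum>b\<in>Basis. - (\<xi> \<bullet> b) * (x \<bullet> b))"
      by (subst euclidean_inner) (simp add: sum_negf mult.commute)
    then have "cis (- (x \<bullet> \<xi>)) = (\<Prod>b\<in>Basis. cis (- (\<xi> \<bullet> b) * (x \<bullet> b)))"
      by (simp only: cis_sum[OF finite_Basis])
    then show ?thesis by (simp add: tensor_def prod.distrib)
  qed
  then have "(LINT x|lborel. cis (- (x \<bullet> \<xi>)) * tensor F x) =
      (\<Prod>b\<in>Basis. LINT t|lborel. cis (- (\<xi> \<bullet> b) * t) * F b t)"
    using F by (simp add: integral_tensor integrable_cis_mult)
  moreover have "(2 * pi) powr (- real DIM('a) / 2) = (\<Prod>b\<in>(Basis::'a set). c)"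
    unfolding c_def by (simp add: powr_power)
  ultimately show "fourier (tensor F) \<xi> = tensor (\<lambda>b. fourier (F b)) \<xi>"
    by (simp only: fourier_def[of "tensor F"] tensor_def[of "\<lambda>b. fourier (F b)"] fourier_real of_real_prod
        prod.distrib c_def)
qed

lemma inv_fourier_tensor:
  fixes F :: "'a::euclidean_space \<Rightarrow> real \<Rightarrow> complex"
  assumes F: "\<And>b. b \<in> Basis \<Longrightarrow> integrable lborel (F b)"
  shows "inv_fourier (tensor F) = tensor (\<lambda>b. inv_fourier (F b))"
proof
  have "fourier (tensor F) = tensor (\<lambda>b. fourier (F b))" by (rule fourier_tensor) (rule F)
  then show "inv_fourier (tensor F) x = tensor (\<lambda>b. inv_fourier (F b)) x" for x
    by (simp add: tensor_def inv_fourier_eq_fourier_minus)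
qed

section \<open>Schwartz functions\<close>

lemma has_derivative_tensor:
  fixes F F' :: "'a::euclidean_space \<Rightarrow> real \<Rightarrow> complex"
  assumes "\<And>b t. b \<in> Basis \<Longrightarrow> (F b has_vector_derivative F' b t) (at t)"
  shows "(tensor F has_derivative
    (\<lambda>h. \<Sum>i\<in>Basis. (h \<bullet> i) *\<^sub>R F' i (x \<bullet> i) * (\<Prod>j\<in>Basis - {i}. F j (x \<bullet> j)))) (at x)"
  unfolding tensor_def
proof (rule has_derivative_prod)
  fix b :: 'a assume b: "b \<in> Basis"
  have "((\<lambda>x. x \<bullet> b) has_derivative (\<lambda>h. h \<bullet> b)) (at x)"
    by (intro derivative_intros)
  moreover have "(F b has_derivative (\<lambda>h. h *\<^sub>R F' b (x \<bullet> b))) (at (x \<bullet> b))"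
    using assms[OF b] by (simp add: has_vector_derivative_def)
  ultimately have "((F b \<circ> (\<lambda>x. x \<bullet> b)) has_derivative (\<lambda>h. h *\<^sub>R F' b (x \<bullet> b)) \<circ> (\<lambda>h. h \<bullet> b)) (at x)"
    by (rule diff_chain_at)
  then show "((\<lambda>x. F b (x \<bullet> b)) has_derivative (\<lambda>h. (h \<bullet> b) *\<^sub>R F' b (x \<bullet> b))) (at x)"
    unfolding o_def .
qed

text \<open>A derivative in direction e raises the order of the factor at e alone, so the order at b
  is the number of times b occurs in the list.\<close>

lemma iter_partial_tensor:
  fixes D :: "'a::euclidean_space \<Rightarrow> nat \<Rightarrow> real \<Rightarrow> complex"
  assumes D: "\<And>b. b \<in> Basis \<Longrightarrow> schwartz_tower (D b)"
  shows "set bs \<subseteq> Basis \<Longrightarrow>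
    iter_partial bs (tensor (\<lambda>b. D b 0)) = tensor (\<lambda>b. D b (count_list bs b))"
proof (induction bs)
  case Nil
  then show ?case by simp
next
  case (Cons e bs)
  then have e: "e \<in> Basis" by simp
  let ?F = "\<lambda>b. D b (count_list bs b)"
  let ?F' = "\<lambda>b. D b (Suc (count_list bs b))"
  have d: "b \<in> Basis \<Longrightarrow> (?F b has_vector_derivative ?F' b t) (at t)" for b t
    using D unfolding schwartz_tower_def by blast
  have "frechet_derivative (tensor ?F) (at x) e = tensor (\<lambda>b. D b (count_list (e # bs) b)) x" for x
  proof -
    have "frechet_derivative (tensor ?F) (at x) e =
        (\<Sum>i\<in>Basis. (e \<bullet> i) *\<^sub>R ?F' i (x \<bullet> i) * (\<Prod>j\<in>Basis - {i}. ?F j (x \<bullet> j)))"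
      using frechet_derivative_at[OF has_derivative_tensor[of ?F ?F', OF d], symmetric] by (simp add: fun_eq_iff)
    \<comment> \<open>Orthonormality of the basis leaves a single term of the product rule.\<close>
    also have "\<dots> = (\<Sum>i\<in>Basis. if i = e then ?F' e (x \<bullet> e) * (\<Prod>j\<in>Basis - {e}. ?F j (x \<bullet> j)) else 0)"
      using e by (intro sum.cong) (auto simp: inner_Basis)
    also have "\<dots> = ?F' e (x \<bullet> e) * (\<Prod>j\<in>Basis - {e}. ?F j (x \<bullet> j))"
      using e by simp
    also have "\<dots> = tensor (\<lambda>b. D b (count_list (e # bs) b)) x"
      unfolding tensor_def prod.remove[OF finite_Basis e]
      by (intro arg_cong2[where f="(*)"] prod.cong) auto
    finally show ?thesis .
  qed
  with Cons show ?case by simp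
qed

text \<open>Splits the isotropic weight of the Schwartz seminorms into one weight per coordinate;
  expanding the product dominates 1 plus the l1 norm.\<close>

lemma one_plus_norm_le: "1 + norm (x::'a::euclidean_space) \<le> (\<Prod>b\<in>Basis. 1 + \<bar>x \<bullet> b\<bar>)"
proof -
  have "1 + (\<Sum>b\<in>A. \<bar>x \<bullet> b\<bar>) \<le> (\<Prod>b\<in>A. 1 + \<bar>x \<bullet> b\<bar>)" if "finite A" for A
    using that
  proof induction
    case (insert a A)
    have "1 * 1 \<le> (\<Prod>b\<in>A. 1 + \<bar>x \<bullet> b\<bar>)" by (simp add: prod_ge_1)
    then have "\<bar>x \<bullet> a\<bar> * 1 \<le> \<bar>x \<bullet> a\<bar> * (\<Prod>b\<in>A. 1 + \<bar>x \<bullet> b\<bar>)" by (intro mult_left_mono) auto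
    with insert show ?case by (simp add: algebra_simps)
  qed auto
  from this[OF finite_Basis] norm_le_l1[of x] show ?thesis by linarith
qed

lemma schwartz_tensor:
  fixes D :: "'a::euclidean_space \<Rightarrow> nat \<Rightarrow> real \<Rightarrow> complex"
  assumes D: "\<And>b. b \<in> Basis \<Longrightarrow> schwartz_tower (D b)"
  shows "schwartz (tensor (\<lambda>b. D b 0))"
  unfolding schwartz_def smooth_def
proof (intro conjI allI impI)
  fix bs :: "'a list" and x
  assume bs: "set bs \<subseteq> Basis"
  have T: "iter_partial bs (tensor (\<lambda>b. D b 0)) = tensor (\<lambda>b. D b (count_list bs b))"
    by (rule iter_partial_tensor[OF _ bs]) (rule D)
  have "\<exists>L. (tensor (\<lambda>b. D b (count_list bs b)) has_derivative L) (at x)"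
    by (rule exI, rule has_derivative_tensor[of _ "\<lambda>b. D b (Suc (count_list bs b))"])
      (use D in \<open>simp add: schwartz_tower_def\<close>)
  then show "iter_partial bs (tensor (\<lambda>b. D b 0)) differentiable at x"
    unfolding T differentiable_def .
next
  fix bs :: "'a list" and N
  assume bs: "set bs \<subseteq> Basis"
  have T: "iter_partial bs (tensor (\<lambda>b. D b 0)) = tensor (\<lambda>b. D b (count_list bs b))"
    by (rule iter_partial_tensor[OF _ bs]) (rule D)
  have "\<forall>b\<in>Basis. \<exists>C. \<forall>t. (1 + \<bar>t\<bar>) ^ N * norm (D b (count_list bs b) t) \<le> C"
    using D unfolding schwartz_tower_def by blast
  then obtain C where C: "\<And>b t. b \<in> Basis \<Longrightarrow> (1 + \<bar>t\<bar>) ^ N * norm (D b (count_list bs b) t) \<le> C b"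
    by metis
  have "(1 + norm x) ^ N * norm (iter_partial bs (tensor (\<lambda>b. D b 0)) x) \<le> (\<Prod>b\<in>Basis. C b)" for x
  proof -
    have "(1 + norm x) ^ N * norm (iter_partial bs (tensor (\<lambda>b. D b 0)) x)
        \<le> (\<Prod>b\<in>Basis. 1 + \<bar>x \<bullet> b\<bar>) ^ N * (\<Prod>b\<in>Basis. norm (D b (count_list bs b) (x \<bullet> b)))"
      unfolding T tensor_def prod_norm
      by (intro mult_mono power_mono one_plus_norm_le prod_nonneg zero_le_power) auto
    also have "\<dots> = (\<Prod>b\<in>Basis. (1 + \<bar>x \<bullet> b\<bar>) ^ N * norm (D b (count_list bs b) (x \<bullet> b)))"
      by (simp add: prod.distrib prod_power_distrib)
    also have "\<dots> \<le> (\<Prod>b\<in>Basis. C b)"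
      using C by (intro prod_mono) auto
    finally show ?thesis .
  qed
  then show "bdd_above (range (\<lambda>x. (1 + norm x) ^ N * norm (iter_partial bs (tensor (\<lambda>b. D b 0)) x)))"
    by (intro bdd_aboveI2)
qed

section \<open>General Schwartz functions and their uniqueness as representatives\<close>

lemma schwartz_continuous:
  assumes "schwartz f"
  shows "continuous_on UNIV f"
proof -
  have "f differentiable (at x)" for x
    using assms unfolding schwartz_def smooth_def by (metis empty_set empty_subsetI iter_partial.simps(1))
  then show ?thesis
    by (simp add: continuous_at_imp_continuous_on differentiable_imp_continuous_within)
qed

lemma schwartz_measurable: "schwartz f \<Longrightarrow> f \<in> borel_measurable borel"
  by (intro borel_measurable_continuous_onI schwartz_continuous)

lemma schwartz_decay:
  assumes "schwartz f"
  obtains C where "\<And>x. (1 + norm x) ^ N * norm (f x) \<le> C"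
proof -
  have "\<forall>N bs. set bs \<subseteq> Basis \<longrightarrow> bdd_above (range (\<lambda>x. (1 + norm x) ^ N * norm (iter_partial bs f x)))"
    using assms unfolding schwartz_def by (rule conjunct2)
  from this[rule_format, of "[]" N]
  have "bdd_above (range (\<lambda>x. (1 + norm x) ^ N * norm (f x)))" by simp
  then obtain C where "\<forall>y\<in>range (\<lambda>x. (1 + norm x) ^ N * norm (f x)). y \<le> C"
    unfolding bdd_above_def by (rule exE)
  then have "(1 + norm x) ^ N * norm (f x) \<le> C" for x by blast
  then show thesis by (rule that)
qed

lemma schwartz_bounded:
  assumes "schwartz f"
  obtains C where "\<And>x. norm (f x) \<le> C"
  using schwartz_decay[OF assms, of 0] by auto

lemma schwartz_integrable:
  fixes f :: "'a::euclidean_space \<Rightarrow> complex"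
  assumes "schwartz f"
  shows "integrable lborel f"
proof -
  \<comment> \<open>Two powers of the weight per coordinate: the product of the 1 + x_b^2 is at most
    (1 + |x|)^(2 DIM), and its inverse is an integrable tensor.\<close>
  obtain C where C: "\<And>x. (1 + norm x) ^ (2 * DIM('a)) * norm (f x) \<le> C"
    using schwartz_decay[OF assms] by blast
  define w where "w = tensor (\<lambda>(b::'a) t. of_real (inverse (1 + t\<^sup>2)))"
  have w: "integrable lborel w"
    unfolding w_def
    by (intro integrable_tensor complex_of_real_integrable_eq[THEN iffD2] integrable_inverse_square_UNIV)
  have "norm (f x) \<le> norm (of_real C * w x)" for x
  proof -
    define P where "P = (\<Prod>b\<in>Basis. 1 + (x \<bullet> b)\<^sup>2)"
    have P0: "P > 0" unfolding P_def by (intro prod_pos ballI add_pos_nonneg) simp_all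
    have "1 + (x \<bullet> b)\<^sup>2 \<le> (1 + norm x)\<^sup>2" if "b \<in> Basis" for b
    proof -
      have "\<bar>x \<bullet> b\<bar>\<^sup>2 \<le> (norm x)\<^sup>2" by (intro power_mono Basis_le_norm that) simp
      then show ?thesis unfolding power2_sum power2_abs power_one mult_1_right using norm_ge_zero[of x] by linarith
    qed
    then have "P \<le> (\<Prod>b\<in>(Basis::'a set). (1 + norm x)\<^sup>2)"
      unfolding P_def by (intro prod_mono) simp
    then have "P \<le> (1 + norm x) ^ (2 * DIM('a))"
      by (simp only: prod_constant power_mult)
    then have "P * norm (f x) \<le> (1 + norm x) ^ (2 * DIM('a)) * norm (f x)"
      by (rule mult_right_mono) simp
    then have "P * norm (f x) \<le> \<bar>C\<bar>" using C[of x] by linarith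
    then have "norm (f x) \<le> \<bar>C\<bar> * inverse P"
      using pos_le_divide_eq[OF P0, of "norm (f x)" "\<bar>C\<bar>"] by (metis divide_inverse mult.commute)
    moreover have "norm (w x) = inverse P"
    proof -
      have "norm (complex_of_real (inverse (1 + t\<^sup>2))) = inverse (1 + t\<^sup>2)" for t
        unfolding norm_of_real by (rule abs_of_nonneg) simp
      then have "norm (w x) = (\<Prod>b\<in>Basis. inverse (1 + (x \<bullet> b)\<^sup>2))"
        unfolding w_def tensor_def prod_norm[symmetric] by (simp only:)
      also have "\<dots> = inverse P"
        unfolding P_def by (rule prod_inversef[unfolded o_def])
      finally show ?thesis .
    qed
    ultimately show ?thesis by (simp only: norm_mult norm_of_real)
  qed
  note bound = this
  show ?thesis
  proof (rule Bochner_Integration.integrable_bound)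
    show "integrable lborel (\<lambda>x. of_real C * w x)" by (rule integrable_mult_right) (rule w)
    show "f \<in> borel_measurable lborel" using schwartz_measurable[OF assms] by simp
    show "AE x in lborel. norm (f x) \<le> norm (of_real C * w x)" by (rule AE_I2) (rule bound)
  qed
qed

lemma smooth_has_derivative:
  assumes "smooth f" "set bs \<subseteq> Basis"
  shows "(iter_partial bs f has_derivative frechet_derivative (iter_partial bs f) (at x)) (at x)"
  using assms unfolding smooth_def by (intro frechet_derivative_works[THEN iffD1]) simp

lemma iter_partial_diff:
  assumes "smooth f" "smooth g" "set bs \<subseteq> Basis"
  shows "iter_partial bs (\<lambda>x. f x - g x) = (\<lambda>x. iter_partial bs f x - iter_partial bs g x)"
  using assms(3)
proof (induction bs)
  case (Cons b bs)
  then have bs: "set bs \<subseteq> Basis"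
    and IH: "iter_partial bs (\<lambda>x. f x - g x) = (\<lambda>x. iter_partial bs f x - iter_partial bs g x)"
    by simp_all
  note d = has_derivative_diff[OF smooth_has_derivative[OF assms(1) bs] smooth_has_derivative[OF assms(2) bs]]
  show ?case
    unfolding iter_partial.simps IH frechet_derivative_at[OF d, symmetric] ..
qed simp

lemma iter_partial_cnj:
  assumes "smooth f" "set bs \<subseteq> Basis"
  shows "iter_partial bs (\<lambda>x. cnj (f x)) = (\<lambda>x. cnj (iter_partial bs f x))"
  using assms(2)
proof (induction bs)
  case (Cons b bs)
  then have bs: "set bs \<subseteq> Basis"
    and IH: "iter_partial bs (\<lambda>x. cnj (f x)) = (\<lambda>x. cnj (iter_partial bs f x))"
    by simp_all
  note d = has_derivative_cnj[OF smooth_has_derivative[OF assms(1) bs]]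
  show ?case
    unfolding iter_partial.simps IH frechet_derivative_at[OF d, symmetric] ..
qed simp

lemma schwartz_diff:
  assumes f: "schwartz f" and g: "schwartz g"
  shows "schwartz (\<lambda>x. f x - g x)"
  unfolding schwartz_def smooth_def
proof (intro conjI allI impI)
  have s: "smooth f" "smooth g" using f g unfolding schwartz_def by auto
  show "iter_partial bs (\<lambda>x. f x - g x) differentiable at x" if "set bs \<subseteq> Basis" for bs x
    using s that unfolding iter_partial_diff[OF s that] smooth_def by (intro differentiable_diff) simp_all
  fix N and bs :: "'a list"
  assume bs: "set bs \<subseteq> Basis"
  obtain A B where "\<And>x. (1 + norm x) ^ N * norm (iter_partial bs f x) \<le> A"
    "\<And>x. (1 + norm x) ^ N * norm (iter_partial bs g x) \<le> B"
    using f g bs unfolding schwartz_def bdd_above_def ball_UNIV ball_simps by meson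
  note AB = this
  have "(1 + norm x) ^ N * norm (iter_partial bs f x - iter_partial bs g x) \<le> A + B" for x
  proof -
    have "(1 + norm x) ^ N * norm (iter_partial bs f x - iter_partial bs g x)
        \<le> (1 + norm x) ^ N * (norm (iter_partial bs f x) + norm (iter_partial bs g x))"
      by (intro mult_left_mono norm_triangle_ineq4) simp
    also have "\<dots> \<le> A + B" unfolding distrib_left by (intro add_mono AB)
    finally show ?thesis .
  qed
  then show "bdd_above (range (\<lambda>x. (1 + norm x) ^ N * norm (iter_partial bs (\<lambda>x. f x - g x) x)))"
    unfolding iter_partial_diff[OF s bs] by (intro bdd_aboveI2)
qed

lemma schwartz_cnj:
  assumes f: "schwartz f"
  shows "schwartz (\<lambda>x. cnj (f x))"
  unfolding schwartz_def smooth_def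
proof (intro conjI allI impI)
  have s: "smooth f" using f unfolding schwartz_def by auto
  show "iter_partial bs (\<lambda>x. cnj (f x)) differentiable at x" if "set bs \<subseteq> Basis" for bs x
    unfolding iter_partial_cnj[OF s that] differentiable_def
    by (rule exI, rule has_derivative_cnj, rule smooth_has_derivative[OF s that])
  show "bdd_above (range (\<lambda>x. (1 + norm x) ^ N * norm (iter_partial bs (\<lambda>x. cnj (f x)) x)))"
    if "set bs \<subseteq> Basis" for N bs
    using f that unfolding iter_partial_cnj[OF s that] schwartz_def by simp
qed

lemma integrable_bounded_mult:
  fixes f g :: "'a::euclidean_space \<Rightarrow> complex"
  assumes "f \<in> borel_measurable borel" "\<And>x. norm (f x) \<le> B" "integrable lborel g"
  shows "integrable lborel (\<lambda>x. f x * g x)"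
proof (rule Bochner_Integration.integrable_bound)
  show "integrable lborel (\<lambda>x. of_real B * g x)" using assms(3) by simp
  show "AE x in lborel. norm (f x * g x) \<le> norm (of_real B * g x)"
    using assms(2) by (auto simp: norm_mult intro!: mult_right_mono order_trans[OF assms(2)])
qed (use assms in auto)

text \<open>The set where d does not vanish is open, and a nonempty open set is not a null
  set.\<close>

lemma continuous_AE_zero:
  fixes d :: "'a::euclidean_space \<Rightarrow> complex"
  assumes "continuous_on UNIV d" "AE x in lborel. d x = 0"
  shows "d x = 0"
proof (rule ccontr)
  assume "d x \<noteq> 0"
  have "open {x. d x \<noteq> 0}"
    using assms(1) by (intro open_Collect_neq continuous_intros)
  then have "\<not> negligible {x. d x \<noteq> 0}" using \<open>d x \<noteq> 0\<close> by (intro open_not_negligible) auto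
  moreover have "negligible {x. d x \<noteq> 0}"
  proof -
    have "{x. d x \<noteq> 0} \<in> null_sets lborel"
      using assms(2) \<open>open _\<close> by (subst AE_iff_null_sets) auto
    then show ?thesis unfolding negligible_iff_null_sets by (rule null_sets_completionI)
  qed
  ultimately show False by blast
qed

text \<open>The difference d of the two functions is tested against its own conjugate, giving zero
  for the integral of |d|^2. Equality has to hold at every point: the trace looks at a hyperplane,
  which is a null set.\<close>

lemma schwartz_eqI:
  fixes f g :: "'a::euclidean_space \<Rightarrow> complex"
  assumes f: "schwartz f" and g: "schwartz g"
    and eq: "\<And>\<phi>. schwartz \<phi> \<Longrightarrow> (LINT x|lborel. f x * \<phi> x) = (LINT x|lborel. g x * \<phi> x)"
  shows "f = g"
proof -
  define d where "d x = f x - g x" for x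
  have d: "schwartz d" unfolding d_def using f g by (rule schwartz_diff)
  define \<phi> where "\<phi> x = cnj (d x)" for x
  have \<phi>: "schwartz \<phi>" unfolding \<phi>_def using d by (rule schwartz_cnj)
  have i: "integrable lborel (\<lambda>x. u x * \<phi> x)" if u: "schwartz u" for u
  proof -
    obtain B where B: "\<And>x. norm (u x) \<le> B" using schwartz_bounded[OF u] by blast
    show ?thesis by (rule integrable_bounded_mult[OF schwartz_measurable[OF u] B schwartz_integrable[OF \<phi>]])
  qed
  have "(LINT x|lborel. d x * \<phi> x) = 0"
    unfolding d_def left_diff_distrib
    using eq[OF \<phi>] by (subst Bochner_Integration.integral_diff[OF i[OF f] i[OF g]]) simp
  moreover have dd: "d x * \<phi> x = of_real ((norm (d x))\<^sup>2)" for x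
    unfolding \<phi>_def by (rule complex_norm_square[symmetric])
  ultimately have "(LINT x|lborel. (norm (d x))\<^sup>2) = 0"
    by (simp del: of_real_power)
  moreover have "integrable lborel (\<lambda>x. (norm (d x))\<^sup>2)"
    using i[OF d] unfolding dd complex_of_real_integrable_eq .
  ultimately have "AE x in lborel. (norm (d x))\<^sup>2 = 0"
    by (subst (asm) integral_nonneg_eq_0_iff_AE) auto
  then have "AE x in lborel. d x = 0" by simp
  from continuous_AE_zero[OF schwartz_continuous[OF d] this] show ?thesis
    by (auto simp: d_def)
qed

section \<open>Norms\<close>

lemma one_le_enn2real: "1 \<le> q \<Longrightarrow> q \<noteq> \<infinity> \<Longrightarrow> 1 \<le> enn2real q"
  using enn2real_mono[of 1 q] by (simp add: less_top)

lemma enn_powr_mono: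
  assumes "0 \<le> s" "x \<le> y"
  shows "enn_powr x s \<le> enn_powr y s"
proof (cases "y = \<infinity>")
  case False
  then have "x \<noteq> \<infinity>" "y < top" using assms(2) by (auto simp: less_top top_unique)
  then have "enn2real x \<le> enn2real y" using assms(2) by (intro enn2real_mono) auto
  then show ?thesis
    using False \<open>x \<noteq> \<infinity>\<close> assms(1) by (simp add: enn_powr_def powr_mono2 ennreal_leI)
qed (simp add: enn_powr_def)

lemma enn_powr_less_top: "x \<noteq> \<infinity> \<Longrightarrow> enn_powr x s < \<infinity>"
  by (simp add: enn_powr_def)

lemma enn_powr_ennreal: "0 \<le> a \<Longrightarrow> enn_powr (ennreal a) s = ennreal (a powr s)"
  by (simp add: enn_powr_def)

lemma enn_powr_inverse: "0 < s \<Longrightarrow> enn_powr (enn_powr x s) (1 / s) = x"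
  by (cases x) (simp_all add: enn_powr_ennreal powr_powr, simp add: enn_powr_def)

text \<open>Lets a single block bound a whole modulation norm from below.\<close>

lemma lq_norm_member:
  assumes "1 \<le> q" "k \<in> A"
  shows "a k \<le> lq_norm q A a"
proof (cases "q = \<infinity>")
  case True
  then show ?thesis using assms by (simp add: lq_norm_def SUP_upper)
next
  case False
  then have q: "1 \<le> enn2real q" by (rule one_le_enn2real[OF assms(1)])
  have "enn_powr (a k) (enn2real q) = (\<Sum>\<^sub>\<infinity>k\<in>{k}. enn_powr (a k) (enn2real q))" by simp
  also have "\<dots> \<le> (\<Sum>\<^sub>\<infinity>k\<in>A. enn_powr (a k) (enn2real q))"
    using assms(2) by (intro infsum_mono_neutral nonneg_summable_on_complete) auto
  finally have "enn_powr (enn_powr (a k) (enn2real q)) (1 / enn2real q) \<le>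
      enn_powr (\<Sum>\<^sub>\<infinity>k\<in>A. enn_powr (a k) (enn2real q)) (1 / enn2real q)"
    using q by (intro enn_powr_mono) auto
  then show ?thesis using False q by (simp add: lq_norm_def enn_powr_inverse)
qed

text \<open>For \<open>q = \<infinity>\<close> the exponent is \<open>1 / enn2real \<infinity> = 1 / 0 = 0\<close>, as it should be.\<close>

lemma lq_norm_finite_support_le:
  assumes q: "1 \<le> q" and F: "finite F" "F \<noteq> {}" "F \<subseteq> A"
    and 0: "\<And>k. k \<in> A - F \<Longrightarrow> a k = 0" and b: "\<And>k. k \<in> F \<Longrightarrow> a k \<le> ennreal b" "0 \<le> b"
  shows "lq_norm q A a \<le> ennreal (real (card F) powr (1 / enn2real q) * b)"
proof (cases "q = \<infinity>")
  case True
  have "a k \<le> ennreal b" if "k \<in> A" for k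
    using that 0 b by (cases "k \<in> F") auto
  moreover have "card F \<noteq> 0" using F by simp
  ultimately show ?thesis using True by (simp add: lq_norm_def SUP_least)
next
  case False
  define s where "s = enn2real q"
  have s: "1 \<le> s" unfolding s_def by (rule one_le_enn2real[OF q False])
  have "(\<Sum>\<^sub>\<infinity>k\<in>A. enn_powr (a k) s) = (\<Sum>\<^sub>\<infinity>k\<in>F. enn_powr (a k) s)"
    using F 0 s by (intro infsum_cong_neutral) (auto simp: enn_powr_def)
  also have "\<dots> = (\<Sum>k\<in>F. enn_powr (a k) s)" using F by simp
  also have "\<dots> \<le> (\<Sum>k\<in>F. ennreal (b powr s))"
    using b s by (intro sum_mono) (metis enn_powr_mono enn_powr_ennreal order.trans zero_le_one)
  also have "\<dots> = ennreal (real (card F) * b powr s)"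
    by (simp add: ennreal_mult ennreal_of_nat_eq_real_of_nat)
  finally have "enn_powr (\<Sum>\<^sub>\<infinity>k\<in>A. enn_powr (a k) s) (1 / s) \<le>
      enn_powr (ennreal (real (card F) * b powr s)) (1 / s)"
    using s by (intro enn_powr_mono) auto
  also have "\<dots> = ennreal (real (card F) powr (1 / s) * b)"
    using s b(2) by (simp add: enn_powr_ennreal powr_mult powr_powr)
  finally show ?thesis using False by (simp add: lq_norm_def s_def)
qed

section \<open>Bounds for Lebesgue norms of functions and distributions\<close>

lemma Lp_norm_zero: "1 \<le> p \<Longrightarrow> Lp_norm p (\<lambda>x. 0) = 0"
  by (simp add: Lp_norm_def enn_powr_def esssup_const)

text \<open>As w takes values in [0, 1], its powers with exponent at least 1 stay below w, so one
  integrable majorant works for every p. The constant is fixed before G, which makes the bound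
  uniform over all blocks.\<close>

lemma Lp_norm_le_dominated:
  fixes w :: "'a::euclidean_space \<Rightarrow> real"
  assumes p: "1 \<le> p" and w: "integrable lborel w" "\<And>x. 0 \<le> w x" "\<And>x. w x \<le> 1" and M: "0 \<le> M"
  obtains K where "0 \<le> K" "\<And>G. G \<in> borel_measurable borel \<Longrightarrow> (\<And>x. norm (G x) \<le> M * w x) \<Longrightarrow>
    Lp_norm p G \<le> ennreal K"
proof (cases "p = \<infinity>")
  case True
  have "Lp_norm p G \<le> ennreal M"
    if G[measurable]: "G \<in> borel_measurable borel" and le: "\<And>x. norm (G x) \<le> M * w x" for G
  proof -
    have "norm (G x) \<le> M" for x
      using le[of x] mult_left_mono[OF w(3)[of x] M] by simp
    then show ?thesis
      unfolding Lp_norm_def using True by (auto intro!: esssup_I AE_I2 ennreal_leI)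
  qed
  with M show ?thesis by (rule that)
next
  case False
  define s where "s = enn2real p"
  have s: "1 \<le> s" unfolding s_def by (rule one_le_enn2real[OF p False])
  define J where "J = (\<integral>\<^sup>+x. ennreal (M powr s * w x) \<partial>lborel)"
  have "J < \<infinity>"
    unfolding J_def
    by (subst nn_integral_eq_integral[OF integrable_mult_right[OF w(1)]]) (simp_all add: w(2))
  define K where "K = enn2real (enn_powr J (1 / s))"
  have K: "ennreal K = enn_powr J (1 / s)"
    unfolding K_def using enn_powr_less_top[of J "1 / s"] \<open>J < \<infinity>\<close> by (simp add: less_top)
  have "Lp_norm p G \<le> ennreal K"
    if G[measurable]: "G \<in> borel_measurable borel" and le: "\<And>x. norm (G x) \<le> M * w x" for G
  proof -
    have "norm (G x) powr s \<le> M powr s * w x" for x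
    proof -
      have "norm (G x) powr s \<le> (M * w x) powr s"
        using le[of x] s by (intro powr_mono2) auto
      also have "\<dots> = M powr s * w x powr s" using M w by (simp add: powr_mult)
      also have "w x powr s \<le> w x"
      proof (cases "w x = 0")
        case False
        then have "w x powr s \<le> w x powr 1" using w s by (intro powr_mono') auto
        then show ?thesis using w by simp
      qed (use s in simp)
      finally show ?thesis by (simp add: mult_left_mono)
    qed
    then have "(\<integral>\<^sup>+x. ennreal (norm (G x) powr s) \<partial>lborel) \<le> J"
      unfolding J_def by (intro nn_integral_mono ennreal_leI)
    then show ?thesis
      unfolding K using False s by (simp add: Lp_norm_def s_def[symmetric] enn_powr_mono)
  qed
  then show ?thesis using that[of K] by (simp add: K_def)
qed

text \<open>A cheap substitute for the inequality of Hoelder, from \<open>y \<le> A (1 + (y / A)\<^sup>p)\<close>.\<close>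

lemma norm_integral_le_Lp_norm:
  fixes G \<phi> :: "'a::euclidean_space \<Rightarrow> complex"
  assumes p: "1 \<le> p" and G[measurable]: "G \<in> borel_measurable borel"
    and \<phi>: "integrable lborel \<phi>" "\<And>x. norm (\<phi> x) \<le> B" and G\<phi>: "integrable lborel (\<lambda>x. G x * \<phi> x)"
    and A: "Lp_norm p G \<le> ennreal A" "0 < A"
  shows "norm (LINT x|lborel. G x * \<phi> x) \<le> A * (B + (LINT x|lborel. norm (\<phi> x)))"
proof -
  have B0: "0 \<le> B" using \<phi>(2) norm_ge_zero order_trans by blast
  show ?thesis
  proof (cases "p = \<infinity>")
    case True
    then have "esssup lborel (\<lambda>x. ennreal (norm (G x))) \<le> ennreal A"
      using A(1) by (simp add: Lp_norm_def)
    moreover have "AE x in lborel. ennreal (norm (G x)) \<le> esssup lborel (\<lambda>x. ennreal (norm (G x)))"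
      by (rule esssup_AE)
    ultimately have "AE x in lborel. ennreal (norm (G x)) \<le> ennreal A"
      by (auto intro: order_trans)
    then have "AE x in lborel. norm (G x * \<phi> x) \<le> A * norm (\<phi> x)"
      using A(2) by (auto simp: norm_mult mult_right_mono)
    moreover have "integrable lborel (\<lambda>x. A * norm (\<phi> x))" using \<phi>(1) by simp
    ultimately have "(LINT x|lborel. norm (G x * \<phi> x)) \<le> (LINT x|lborel. A * norm (\<phi> x))"
      by (intro integral_mono_AE integrable_norm[OF G\<phi>])
    then have "norm (LINT x|lborel. G x * \<phi> x) \<le> (LINT x|lborel. A * norm (\<phi> x))"
      by (rule order_trans[OF integral_norm_bound])
    also have "\<dots> \<le> A * (B + (LINT x|lborel. norm (\<phi> x)))"
      using A(2) B0 by (simp add: algebra_simps)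
    finally show ?thesis .
  next
    case False
    define s where "s = enn2real p"
    have s: "1 \<le> s" unfolding s_def by (rule one_le_enn2real[OF p False])
    define I where "I = (\<integral>\<^sup>+x. ennreal (norm (G x) powr s) \<partial>lborel)"
    have "enn_powr I (1 / s) \<le> ennreal A"
      using A(1) False by (simp add: Lp_norm_def s_def I_def)
    then have "enn_powr (enn_powr I (1 / s)) s \<le> enn_powr (ennreal A) s"
      using s by (intro enn_powr_mono) auto
    then have I: "I \<le> ennreal (A powr s)"
      using enn_powr_inverse[of "1 / s" I] s A(2) by (simp add: enn_powr_ennreal)
    have int: "integrable lborel (\<lambda>x. norm (G x) powr s)"
      using I by (intro integrableI_bounded) (auto simp: I_def intro: le_less_trans)
    have "ennreal (LINT x|lborel. norm (G x) powr s) = I"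
      unfolding I_def by (rule nn_integral_eq_integral[symmetric, OF int]) simp
    with I have IA: "(LINT x|lborel. norm (G x) powr s) \<le> A powr s"
      by (metis ennreal_le_iff powr_ge_zero)
    have "norm (LINT x|lborel. G x * \<phi> x) \<le>
        (LINT x|lborel. A * norm (\<phi> x) + A * B / A powr s * norm (G x) powr s)"
    proof (rule Bochner_Integration.integral_norm_bound_integral[OF G\<phi>])
      show "integrable lborel (\<lambda>x. A * norm (\<phi> x) + A * B / A powr s * norm (G x) powr s)"
        using \<phi>(1) int by (intro Bochner_Integration.integrable_add integrable_mult_right integrable_norm)
      show "norm (G x * \<phi> x) \<le> A * norm (\<phi> x) + A * B / A powr s * norm (G x) powr s" for x
      proof -
        define y where "y = norm (G x) / A"
        have y: "0 \<le> y" "norm (G x) = A * y" using A(2) by (auto simp: y_def)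
        have "norm (G x * \<phi> x) = A * (y * norm (\<phi> x))" by (simp add: norm_mult y)
        also have "y * norm (\<phi> x) \<le> norm (\<phi> x) + B * y powr s"
        proof (cases "y \<le> 1")
          case True
          then have "y * norm (\<phi> x) \<le> 1 * norm (\<phi> x)" by (intro mult_right_mono) auto
          moreover have "0 \<le> B * y powr s" using B0 by simp
          ultimately show ?thesis by linarith
        next
          case False
          then have "y powr 1 \<le> y powr s" using s by (intro powr_mono) auto
          then have "y * norm (\<phi> x) \<le> y powr s * B" using False \<phi>(2) by (intro mult_mono) auto
          then show ?thesis by (simp add: mult.commute add_increasing)
        qed
        also have "A * (norm (\<phi> x) + B * y powr s) = A * norm (\<phi> x) + A * B / A powr s * norm (G x) powr s"
          using A(2) by (simp add: y_def powr_divide algebra_simps)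
        finally show ?thesis using A(2) by simp
      qed
    qed
    also have "\<dots> = A * (LINT x|lborel. norm (\<phi> x)) + A * B / A powr s * (LINT x|lborel. norm (G x) powr s)"
      using \<phi>(1) int by simp
    also have "\<dots> \<le> A * (LINT x|lborel. norm (\<phi> x)) + A * B / A powr s * A powr s"
      using IA A(2) B0 by (intro add_left_mono mult_left_mono) auto
    also have "\<dots> = A * (B + (LINT x|lborel. norm (\<phi> x)))"
      using A(2) by (simp add: algebra_simps)
    finally show ?thesis .
  qed
qed

text \<open>The value of u at one test function controls every representing function from below. The
  denominator is the constant of the preceding pairing estimate, in place of a dual norm.\<close>

lemma Lp_norm_distr_ge:
  fixes u :: "'a::euclidean_space distr"
  assumes p: "1 \<le> p" and \<phi>: "schwartz \<phi>" "\<And>x. norm (\<phi> x) \<le> B" and B: "0 < B"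
  shows "ennreal (norm (u \<phi>) / (B + (LINT x|lborel. norm (\<phi> x)))) \<le> Lp_norm_distr p u"
  unfolding Lp_norm_distr_def
proof (rule INF_greatest)
  fix G assume "G \<in> {g. represents g u}"
  then have G: "G \<in> borel_measurable borel" and G\<phi>: "integrable lborel (\<lambda>x. G x * \<phi> x)"
    and u: "u \<phi> = (LINT x|lborel. G x * \<phi> x)"
    using \<phi>(1) unfolding represents_def by auto
  have "ennreal (norm (u \<phi>) / K) \<le> Lp_norm p G" if "K = B + (LINT x|lborel. norm (\<phi> x))" for K
  proof (rule ccontr)
    assume "\<not> ennreal (norm (u \<phi>) / K) \<le> Lp_norm p G"
    then have lt: "Lp_norm p G < ennreal (norm (u \<phi>) / K)" by simp
    have K: "0 < K" unfolding that using B by (simp add: add_pos_nonneg)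
    \<comment> \<open>The pairing estimate needs a positive real bound, whereas the norm itself may
      be 0; an intermediate value is both positive and finite.\<close>
    obtain z where z: "Lp_norm p G < z" "z < ennreal (norm (u \<phi>) / K)"
      using dense[OF lt] by blast
    define A where "A = enn2real z"
    have "z < top" by (rule less_trans[OF z(2) ennreal_less_top])
    then have zA: "z = ennreal A" and A0: "0 < A"
      unfolding A_def using z(1) by (simp_all add: enn2real_positive_iff le_less_trans[of 0])
    have "norm (u \<phi>) \<le> A * K"
      unfolding u that using z(1) zA A0
      by (intro norm_integral_le_Lp_norm[OF p G schwartz_integrable[OF \<phi>(1)] \<phi>(2) G\<phi>]) auto
    moreover have "A < norm (u \<phi>) / K" using z(2) A0 unfolding zA by (simp add: ennreal_less_iff)
    ultimately show False using K by (simp add: field_simps)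
  qed
  from this[OF refl] show "ennreal (norm (u \<phi>) / (B + (LINT x|lborel. norm (\<phi> x)))) \<le> Lp_norm p G" .
qed

section \<open>The frequency-uniform decomposition of tensor products\<close>

locale decomposition_profile =
  fixes \<eta> :: "real \<Rightarrow> real"
  assumes smooth_eta: "smooth \<eta>" and eta_nonneg: "0 \<le> \<eta> t"
    and eta_eq_1: "\<bar>t\<bar> \<le> 1 \<Longrightarrow> \<eta> t = 1" and eta_eq_0: "2 \<le> \<bar>t\<bar> \<Longrightarrow> \<eta> t = 0"
begin

text \<open>The one-dimensional denominator, that is, the sum over all integers m. Only the two
  neighbours of t can contribute, because \<eta>(2s) vanishes for |s| at least 1.\<close>

definition eta_sum :: "real \<Rightarrow> real" where
  "eta_sum t = (\<Sum>m\<in>{\<lfloor>t\<rfloor>, \<lfloor>t\<rfloor> + 1}. \<eta> (2 * (t - of_int m)))"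

lemma eta4_nonzero: "\<eta> (4 * s) \<noteq> 0 \<Longrightarrow> \<bar>s\<bar> < 1 / 2"
  using eta_eq_0[of "4 * s"] by (cases "2 \<le> \<bar>4 * s\<bar>") (simp_all add: abs_mult)

lemma eta2_nonzero: "\<eta> (2 * s) \<noteq> 0 \<Longrightarrow> \<bar>s\<bar> < 1"
  using eta_eq_0[of "2 * s"] by (cases "2 \<le> \<bar>2 * s\<bar>") (simp_all add: abs_mult)

lemma eta_shift_nonzero:
  assumes "\<eta> (2 * (t - of_int m)) \<noteq> 0"
  shows "m \<in> {\<lfloor>t\<rfloor>, \<lfloor>t\<rfloor> + 1}"
proof -
  have "\<bar>t - of_int m\<bar> < 1" by (rule eta2_nonzero[OF assms])
  then have "m = \<lfloor>t\<rfloor> \<or> m = \<lfloor>t\<rfloor> + 1" by linarith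
  then show ?thesis by simp
qed

lemma eta_sum_eq:
  assumes "finite I" "{\<lfloor>t\<rfloor>, \<lfloor>t\<rfloor> + 1} \<subseteq> I"
  shows "eta_sum t = (\<Sum>m\<in>I. \<eta> (2 * (t - of_int m)))"
  unfolding eta_sum_def using assms eta_shift_nonzero[of t] by (intro sum.mono_neutral_left) blast+

text \<open>Some integer lies within 1/2 of t, and its summand equals 1. Division by this sum is
  therefore harmless and never increases the numerator.\<close>

lemma eta_sum_ge_1: "1 \<le> eta_sum t"
proof -
  have "\<exists>m\<in>{\<lfloor>t\<rfloor>, \<lfloor>t\<rfloor> + 1}. \<eta> (2 * (t - of_int m)) = 1"
  proof (cases "t - of_int \<lfloor>t\<rfloor> \<le> 1 / 2")
    case True
    then have "\<bar>2 * (t - of_int \<lfloor>t\<rfloor>)\<bar> \<le> 1"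
      using of_int_floor_le[of t] by (simp add: abs_le_iff)
    from eta_eq_1[OF this] show ?thesis by simp
  next
    case False
    then have "\<bar>2 * (t - of_int (\<lfloor>t\<rfloor> + 1))\<bar> \<le> 1"
      using floor_correct[of t] unfolding abs_le_iff of_int_add of_int_1 by argo
    from eta_eq_1[OF this] show ?thesis by simp
  qed
  then obtain m where m: "m \<in> {\<lfloor>t\<rfloor>, \<lfloor>t\<rfloor> + 1}" "\<eta> (2 * (t - of_int m)) = 1" by blast
  have "\<eta> (2 * (t - of_int m)) \<le> eta_sum t"
    unfolding eta_sum_def by (rule member_le_sum[OF m(1)]) (auto simp: eta_nonneg)
  then show ?thesis using m(2) by simp
qed

lemma bump_eta: "a \<noteq> 0 \<Longrightarrow> bump (\<lambda>t. of_real (\<eta> (a * t + b)))"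
proof (rule bump_affine)
  show "bump (\<lambda>t. of_real (\<eta> t))"
    unfolding bump_def using smooth_imp_C_k[OF smooth_eta] eta_eq_0
    by (intro conjI allI exI[of _ 2]) simp_all
qed

lemma bump_eta_shift: "bump (\<lambda>t. of_real (\<eta> (2 * (t - k))))"
  using bump_eta[of 2 "- (2 * k)"] by (simp add: algebra_simps)

lemma bump_eta_shift4: "bump (\<lambda>t. of_real (\<eta> (4 * (t - k))))"
  using bump_eta[of 4 "- (4 * k)"] by (simp add: algebra_simps)

lemma C_k_eta_shift: "C_k n (\<lambda>t. of_real (\<eta> (2 * (t - k))))"
  using bump_eta_shift unfolding bump_def by blast

lemma eta_measurable [measurable]: "\<eta> \<in> borel_measurable borel"
proof -
  have "continuous_on UNIV (\<lambda>t. Re (of_real (\<eta> t)))"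
    using smooth_imp_C_k[OF smooth_eta, of 0] by (intro continuous_on_Re) simp
  then show ?thesis by (intro borel_measurable_continuous_onI) simp
qed

lemma eta_sum_measurable [measurable]: "eta_sum \<in> borel_measurable borel"
proof -
  have "eta_sum = (\<lambda>t. \<eta> (2 * (t - of_int \<lfloor>t\<rfloor>)) + \<eta> (2 * (t - of_int (\<lfloor>t\<rfloor> + 1))))"
    by (simp add: eta_sum_def fun_eq_iff)
  also have "\<dots> \<in> borel_measurable borel" by measurable
  finally show ?thesis .
qed

text \<open>Expanding the product of two-term sums yields one term for each choice of a neighbour in
  every coordinate. These choices are finitely many lattice points, and at all others some factor
  vanishes.\<close>

lemma psi_denominator:
  fixes \<xi> :: "'a::euclidean_space"
  shows "(\<Sum>\<^sub>\<infinity>m\<in>int_lattice. \<Prod>b\<in>Basis. \<eta> (2 * (\<xi> \<bullet> b - m \<bullet> b))) = (\<Prod>b\<in>Basis. eta_sum (\<xi> \<bullet> b))"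
proof -
  define T where "T b = {\<lfloor>\<xi> \<bullet> b\<rfloor>, \<lfloor>\<xi> \<bullet> b\<rfloor> + 1}" for b
  define P where "P = PiE Basis T"
  define g where "g f = (\<Sum>b\<in>Basis. of_int (f b) *\<^sub>R b)" for f :: "'a \<Rightarrow> int"
  define F where "F m = (\<Prod>b\<in>Basis. \<eta> (2 * (\<xi> \<bullet> b - m \<bullet> b)))" for m
  have g: "g f \<bullet> b = of_int (f b)" if "b \<in> Basis" for f b
    unfolding g_def using that by (simp add: inner_sum_left_Basis)
  have finP: "finite P" unfolding P_def T_def by (intro finite_PiE) auto
  have inj: "inj_on g P"
  proof (rule inj_onI)
    fix f f' assume f: "f \<in> P" "f' \<in> P" and eq: "g f = g f'"
    have "f b = f' b" if "b \<in> Basis" for b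
      using g[OF that, of f] g[OF that, of f'] eq by simp
    then show "f = f'" using f unfolding P_def by (intro PiE_ext[of f Basis T f']) auto
  qed
  have "(\<Prod>b\<in>Basis. eta_sum (\<xi> \<bullet> b)) = (\<Sum>f\<in>P. \<Prod>b\<in>Basis. \<eta> (2 * (\<xi> \<bullet> b - of_int (f b))))"
    unfolding eta_sum_def P_def T_def by (rule prod_sum_PiE) auto
  also have "\<dots> = (\<Sum>f\<in>P. F (g f))"
    unfolding F_def by (intro sum.cong refl prod.cong) (simp add: g)
  also have "\<dots> = (\<Sum>m\<in>g ` P. F m)" using inj by (simp add: sum.reindex)
  also have "\<dots> = (\<Sum>\<^sub>\<infinity>m\<in>g ` P. F m)" using finP by simp
  also have "\<dots> = (\<Sum>\<^sub>\<infinity>m\<in>int_lattice. F m)"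
  proof (rule infsum_cong_neutral)
    fix m :: 'a assume "m \<in> int_lattice - g ` P"
    then have m: "m \<in> int_lattice" "m \<notin> g ` P" by auto
    show "F m = 0"
    proof (rule ccontr)
      assume nz: "F m \<noteq> 0"
      define f where "f = restrict (\<lambda>b. \<lfloor>m \<bullet> b\<rfloor>) Basis"
      have mf: "m \<bullet> b = of_int (f b)" if "b \<in> Basis" for b
        using m(1) that unfolding int_lattice_def f_def by simp
      have "f b \<in> T b" if "b \<in> Basis" for b
      proof -
        have "\<eta> (2 * (\<xi> \<bullet> b - m \<bullet> b)) \<noteq> 0" using nz that unfolding F_def by simp
        then show ?thesis unfolding T_def mf[OF that] by (rule eta_shift_nonzero)
      qed
      then have "f \<in> P" unfolding P_def f_def by (intro restrict_PiE_iff[THEN iffD2]) (simp add: f_def)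
      moreover have "g f = m" by (rule euclidean_eqI) (simp add: g mf)
      ultimately show False using m(2) by blast
    qed
  next
    fix m assume "m \<in> g ` P - int_lattice"
    then show "F m = 0" using g unfolding int_lattice_def by auto
  qed simp
  finally show ?thesis unfolding F_def by simp
qed

lemma psi_eq_tensor:
  "complex_of_real (psi \<eta> k \<xi>) = tensor (\<lambda>b t. of_real (\<eta> (2 * (t - k \<bullet> b)) / eta_sum t)) \<xi>"
  unfolding psi_def psi_denominator tensor_def by (simp add: prod_dividef)

text \<open>Each coordinate factor is dominated by its numerator, a bump. This is all that is used
  of \<open>psi\<close> when transforms are moved.\<close>

lemma psi_integrable:
  fixes k :: "'a::euclidean_space"
  shows "integrable lborel (\<lambda>\<xi>. complex_of_real (psi \<eta> k \<xi>))"
  unfolding psi_eq_tensor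
proof (rule integrable_tensor)
  fix b :: 'a
  show "integrable lborel (\<lambda>t. complex_of_real (\<eta> (2 * (t - k \<bullet> b)) / eta_sum t))"
  proof (rule Bochner_Integration.integrable_bound[OF bump_integrable[OF bump_eta_shift[of "k \<bullet> b"]]])
    show "AE t in lborel. norm (complex_of_real (\<eta> (2 * (t - k \<bullet> b)) / eta_sum t))
        \<le> norm (complex_of_real (\<eta> (2 * (t - k \<bullet> b))))"
    proof (rule AE_I2)
      fix t
      show "norm (complex_of_real (\<eta> (2 * (t - k \<bullet> b)) / eta_sum t))
        \<le> norm (complex_of_real (\<eta> (2 * (t - k \<bullet> b))))"
        unfolding norm_of_real abs_divide using eta_sum_ge_1[of t]
        by (intro divide_le_eq[THEN iffD2]) (simp add: mult_le_cancel_left1)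
    qed
  qed measurable
qed

text \<open>
  A sum of copies of the bump \<open>\<eta> (4 t)\<close> at distance three, times \<open>eta_sum\<close> in order to cancel the
  denominator of \<open>psi\<close>; \<open>slice J k\<close> is what \<open>psi\<close> cuts out of it.
\<close>

definition comb :: "int set \<Rightarrow> real \<Rightarrow> complex" where
  "comb J t = of_real (eta_sum t * (\<Sum>j\<in>J. \<eta> (4 * (t - 3 * of_int j))))"

definition slice :: "int set \<Rightarrow> real \<Rightarrow> real \<Rightarrow> complex" where
  "slice J k t = of_real (\<eta> (2 * (t - k)) * (\<Sum>j\<in>J. \<eta> (4 * (t - 3 * of_int j))))"

text \<open>\<open>eta_sum\<close> is written with floors, so its smoothness is not visible. On the
  support of a tooth it agrees with a sum over a fixed set of integers, and that sum is manifestly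
  smooth.\<close>

lemma bump_comb: "bump (comb J)"
proof -
  have "comb J t = (\<Sum>j\<in>J. \<Sum>m\<in>{3 * j - 1..3 * j + 1}.
      of_real (\<eta> (2 * (t - of_int m))) * of_real (\<eta> (4 * (t - 3 * of_int j))))" for t
  proof -
    have "eta_sum t * \<eta> (4 * (t - 3 * of_int j)) =
        (\<Sum>m\<in>{3 * j - 1..3 * j + 1}. \<eta> (2 * (t - of_int m))) * \<eta> (4 * (t - 3 * of_int j))" for j
    proof (cases "\<eta> (4 * (t - 3 * of_int j)) = 0")
      case False
      have "\<bar>t - 3 * of_int j\<bar> < 1 / 2" by (rule eta4_nonzero[OF False])
      \<comment> \<open>The tooth has radius 1/2, so t may lie on either side of 3j; with the second
        neighbour this gives the three indices from 3j - 1 to 3j + 1.\<close>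
      then have "3 * j - 1 \<le> \<lfloor>t\<rfloor>" "\<lfloor>t\<rfloor> \<le> 3 * j" by linarith+
      then have "eta_sum t = (\<Sum>m\<in>{3 * j - 1..3 * j + 1}. \<eta> (2 * (t - of_int m)))"
        by (intro eta_sum_eq) auto
      then show ?thesis by simp
    qed simp
    then show ?thesis
      unfolding comb_def by (simp add: sum_distrib_left sum_distrib_right)
  qed
  then have "comb J = (\<lambda>t. \<Sum>j\<in>J. \<Sum>m\<in>{3 * j - 1..3 * j + 1}.
      of_real (\<eta> (2 * (t - of_int m))) * of_real (\<eta> (4 * (t - 3 * of_int j))))" by blast
  moreover have "bump \<dots>"
    by (intro bump_sum bump_mult C_k_eta_shift bump_eta_shift4)
  ultimately show ?thesis by simp
qed

lemma bump_slice: "bump (slice J k)"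
proof -
  have "slice J k = (\<lambda>t. \<Sum>j\<in>J. of_real (\<eta> (2 * (t - k))) * of_real (\<eta> (4 * (t - 3 * of_int j))))"
    by (simp add: slice_def fun_eq_iff sum_distrib_left)
  moreover have "bump \<dots>"
    by (intro bump_sum bump_mult C_k_eta_shift bump_eta_shift4)
  ultimately show ?thesis by simp
qed

lemma psi_mult_comb: "of_real (\<eta> (2 * (t - k)) / eta_sum t) * comb J t = slice J k t"
  using eta_sum_ge_1[of t] by (simp add: comb_def slice_def)

text \<open>Window radius 1 plus tooth radius 1/2 is 3/2, so at this distance the supports no longer
  meet.\<close>

lemma slice_eq_0:
  assumes "\<And>j. j \<in> J \<Longrightarrow> 3 / 2 \<le> \<bar>k - 3 * of_int j\<bar>"
  shows "slice J k = (\<lambda>t. 0)"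
proof
  fix t
  have "\<eta> (2 * (t - k)) * \<eta> (4 * (t - 3 * of_int j)) = 0" if j: "j \<in> J" for j
  proof (rule ccontr)
    assume "\<eta> (2 * (t - k)) * \<eta> (4 * (t - 3 * of_int j)) \<noteq> 0"
    then have "\<bar>t - k\<bar> < 1" "\<bar>t - 3 * of_int j\<bar> < 1 / 2"
      using eta2_nonzero eta4_nonzero by auto
    with assms[OF j] show False by linarith
  qed
  then have "\<eta> (2 * (t - k)) * (\<Sum>j\<in>J. \<eta> (4 * (t - 3 * of_int j))) = 0"
    unfolding sum_distrib_left by (intro sum.neutral ballI)
  then show "slice J k t = 0" by (simp only: slice_def of_real_0)
qed

lemma slice_eq_shift:
  assumes "finite J" "j \<in> J" "\<bar>k - 3 * of_int j\<bar> < 3 / 2"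
  shows "slice J k t = slice {0} (k - 3 * of_int j) (t - 3 * of_int j)"
proof -
  have "\<eta> (2 * (t - k)) * \<eta> (4 * (t - 3 * of_int i)) = 0" if i: "i \<in> J - {j}" for i
  proof (rule ccontr)
    assume "\<eta> (2 * (t - k)) * \<eta> (4 * (t - 3 * of_int i)) \<noteq> 0"
    then have "\<bar>t - k\<bar> < 1" "\<bar>t - 3 * of_int i\<bar> < 1 / 2"
      using eta2_nonzero eta4_nonzero by auto
    \<comment> \<open>The bounds 1/2, 1 and 3/2 add up to |3i - 3j| < 3; this is where the spacing
      three is used.\<close>
    with assms(3) have "\<bar>of_int i - of_int j :: real\<bar> < 1" by linarith
    then have "i = j" by linarith
    with i show False by simp
  qed
  then have "(\<Sum>i\<in>J - {j}. \<eta> (2 * (t - k)) * \<eta> (4 * (t - 3 * of_int i))) = 0"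
    by (intro sum.neutral ballI)
  then have "\<eta> (2 * (t - k)) * (\<Sum>i\<in>J. \<eta> (4 * (t - 3 * of_int i))) =
      \<eta> (2 * (t - k)) * \<eta> (4 * (t - 3 * of_int j))"
    unfolding sum.remove[OF assms(1,2)] distrib_left sum_distrib_left by (simp only: add_0_right)
  then have "slice J k t = of_real (\<eta> (2 * (t - k)) * \<eta> (4 * (t - 3 * of_int j)))"
    by (simp only: slice_def)
  then show ?thesis by (simp add: slice_def)
qed

text \<open>A translation in frequency becomes multiplication by a character, which has modulus
  one.\<close>

lemma norm_inv_fourier_shift: "norm (inv_fourier (\<lambda>t. f (t - a)) x) = norm (inv_fourier f x)"
  for f :: "real \<Rightarrow> complex"
proof -
  have "(LINT t|lborel. cis (x * t) * f (t - a)) = (LINT t|lborel. cis (x * (a + 1 * t)) * f (a + 1 * t - a))"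
    by (subst lborel_integral_real_affine[where c=1 and t=a]) simp_all
  also have "\<dots> = (LINT t|lborel. cis (x * a) * (cis (x * t) * f t))"
    by (simp add: distrib_left mult.assoc flip: cis_mult)
  also have "\<dots> = cis (x * a) * (LINT t|lborel. cis (x * t) * f t)"
    by (rule integral_mult_right_zero)
  finally show ?thesis by (simp add: inv_fourier_def norm_mult)
qed

text \<open>Up to a translation, which does not affect the modulus, a nonzero slice at an integer
  frequency is one of the three slices of the tooth at 0. Three constants thus give a bound uniform
  in J and k.\<close>

lemma slice_decay:
  obtains M where "1 \<le> M" "\<And>J k x. finite J \<Longrightarrow> k \<in> \<int> \<Longrightarrow>
    norm (inv_fourier (slice J k) x) \<le> M * inverse (1 + x\<^sup>2)"
proof -
  have "\<exists>M\<ge>0. \<forall>x. norm (inv_fourier (slice {0} d) x) \<le> M * inverse (1 + x\<^sup>2)" for d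
  proof -
    obtain D where D: "schwartz_tower D" "D 0 = inv_fourier (slice {0} d)"
      by (rule inv_fourier_bump_tower[OF bump_slice])
    obtain M where "0 \<le> M" "\<And>x. norm (D 0 x) \<le> M * inverse (1 + x\<^sup>2)"
      by (rule schwartz_tower_bound[OF D(1), of 0]) blast
    then show ?thesis unfolding D(2) by blast
  qed
  then obtain m where m0: "\<And>d. 0 \<le> m d"
    and m: "\<And>d x. norm (inv_fourier (slice {0} d) x) \<le> m d * inverse (1 + x\<^sup>2)" by metis
  define M where "M = 1 + (m (-1) + m 0 + m 1)"
  show thesis
  proof (rule that)
    show "1 \<le> M" using m0[of "-1"] m0[of 0] m0[of 1] unfolding M_def by linarith
    fix J :: "int set" and k x :: real
    assume J: "finite J" and k: "k \<in> \<int>"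
    have i: "0 \<le> inverse (1 + x\<^sup>2)" by simp
    show "norm (inv_fourier (slice J k) x) \<le> M * inverse (1 + x\<^sup>2)"
    proof (cases "\<exists>j\<in>J. \<bar>k - 3 * of_int j\<bar> < 3 / 2")
      case True
      then obtain j where j: "j \<in> J" "\<bar>k - 3 * of_int j\<bar> < 3 / 2" by blast
      define d where "d = k - 3 * of_int j"
      obtain k' where k': "k = of_int k'" using k by (rule Ints_cases)
      \<comment> \<open>An integer of modulus below 3/2 is -1, 0 or 1.\<close>
      have "\<bar>k' - 3 * j\<bar> < 2" using j(2) unfolding k' by linarith
      then have "k' - 3 * j = -1 \<or> k' - 3 * j = 0 \<or> k' - 3 * j = 1" by linarith
      then have "d = -1 \<or> d = 0 \<or> d = 1" unfolding d_def k' by linarith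
      then have dM: "m d \<le> M" using m0[of "-1"] m0[of 0] m0[of 1] unfolding M_def by fastforce
      have "slice J k = (\<lambda>t. slice {0} d (t - 3 * of_int j))"
        unfolding d_def using slice_eq_shift[OF J j] by (intro ext)
      then have "norm (inv_fourier (slice J k) x) = norm (inv_fourier (slice {0} d) x)"
        by (simp only: norm_inv_fourier_shift)
      also have "\<dots> \<le> m d * inverse (1 + x\<^sup>2)" by (rule m)
      also have "\<dots> \<le> M * inverse (1 + x\<^sup>2)" by (rule mult_right_mono[OF dM i])
      finally show ?thesis .
    next
      case False
      then have "slice J k = (\<lambda>t. 0)" by (intro slice_eq_0) force
      then have "inv_fourier (slice J k) x = 0" by (simp add: inv_fourier_def)
      then show ?thesis using \<open>1 \<le> M\<close> i by simp
    qed
  qed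
qed

end

section \<open>Schwartz functions as distributions, and tensors of transforms\<close>

lemma integral_functional_tempered:
  fixes h :: "'a::euclidean_space \<Rightarrow> complex"
  assumes h: "schwartz h"
  shows "tempered (\<lambda>\<phi>. LINT x|lborel. h x * \<phi> x)"
  unfolding tempered_def
proof (intro conjI allI impI)
  have int: "integrable lborel (\<lambda>x. h x * \<phi> x)" if \<phi>: "schwartz \<phi>" for \<phi>
  proof -
    obtain B where B: "\<And>x. norm (h x) \<le> B" using schwartz_bounded[OF h] by blast
    show ?thesis
      by (rule integrable_bounded_mult[OF schwartz_measurable[OF h] B schwartz_integrable[OF \<phi>]])
  qed
  show "(LINT x|lborel. h x * (\<phi> x + \<rho> x)) = (LINT x|lborel. h x * \<phi> x) + (LINT x|lborel. h x * \<rho> x)"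
    if "schwartz \<phi>" "schwartz \<rho>" for \<phi> \<rho>
    unfolding distrib_left by (rule Bochner_Integration.integral_add[OF int int]) fact+
  show "(LINT x|lborel. h x * (c * \<phi> x)) = c * (LINT x|lborel. h x * \<phi> x)" for c \<phi>
    unfolding mult.left_commute[of _ c] by (rule integral_mult_right_zero)
  show "\<exists>C N. \<forall>\<phi>. schwartz \<phi> \<longrightarrow>
      norm (LINT x|lborel. h x * \<phi> x) \<le> C * schwartz_seminorm N \<phi>"
  \<comment> \<open>The seminorm of order 0 runs over the empty list alone and is the sup norm, so
    the L1 norm of h serves as the constant.\<close>
  proof (intro exI[of _ "LINT x|lborel. norm (h x)"] exI[of _ 0] allI impI)
    fix \<phi> :: "'a \<Rightarrow> complex" assume \<phi>: "schwartz \<phi>"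
    obtain B where "\<And>x. norm (\<phi> x) \<le> B" using schwartz_bounded[OF \<phi>] by blast
    then have bdd: "bdd_above (range (\<lambda>x. norm (\<phi> x)))" by (intro bdd_aboveI2)
    have "{bs :: 'a list. set bs \<subseteq> Basis \<and> length bs \<le> 0} = {[]}" by auto
    then have sn: "schwartz_seminorm 0 \<phi> = (SUP x. norm (\<phi> x))"
      unfolding schwartz_seminorm_def by simp
    have "norm (LINT x|lborel. h x * \<phi> x) \<le> (LINT x|lborel. norm (h x) * schwartz_seminorm 0 \<phi>)"
    proof (rule Bochner_Integration.integral_norm_bound_integral[OF int[OF \<phi>]])
      show "integrable lborel (\<lambda>x. norm (h x) * schwartz_seminorm 0 \<phi>)"
        by (intro integrable_mult_left integrable_norm schwartz_integrable h)
      show "norm (h x * \<phi> x) \<le> norm (h x) * schwartz_seminorm 0 \<phi>" for x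
        unfolding norm_mult sn by (intro mult_left_mono cSUP_upper bdd) simp_all
    qed
    then show "norm (LINT x|lborel. h x * \<phi> x) \<le> (LINT x|lborel. norm (h x)) * schwartz_seminorm 0 \<phi>"
      by simp
  qed
qed

lemma schwartz_represents:
  assumes h: "schwartz h"
  shows "represents h (\<lambda>\<phi>. LINT x|lborel. h x * \<phi> x)"
  unfolding represents_def
proof (intro conjI allI impI refl)
  show "h \<in> borel_measurable lborel" using schwartz_measurable[OF h] by simp
  obtain B where B: "\<And>x. norm (h x) \<le> B" using schwartz_bounded[OF h] by blast
  show "integrable lborel (\<lambda>x. h x * \<phi> x)" if \<phi>: "schwartz \<phi>" for \<phi>
    by (rule integrable_bounded_mult[OF schwartz_measurable[OF h] B schwartz_integrable[OF \<phi>]])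
qed

lemma schwartz_tensor_of_towers:
  fixes G :: "'a::euclidean_space \<Rightarrow> real \<Rightarrow> complex"
  assumes "\<And>b. b \<in> Basis \<Longrightarrow> \<exists>D. schwartz_tower D \<and> D 0 = G b"
  shows "schwartz (tensor G)"
proof -
  have "\<forall>b\<in>Basis. \<exists>D. schwartz_tower D \<and> D 0 = G b" using assms by simp
  from bchoice[OF this] obtain D where D: "\<forall>b\<in>Basis. schwartz_tower (D b) \<and> D b 0 = G b" ..
  have "schwartz (tensor (\<lambda>b. D b 0))" by (rule schwartz_tensor) (simp add: D)
  also have "tensor (\<lambda>b. D b 0) = tensor G" by (rule tensor_cong) (simp add: D)
  finally show ?thesis .
qed

lemma schwartz_tensor_fourier:
  fixes F :: "'a::euclidean_space \<Rightarrow> real \<Rightarrow> complex"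
  assumes "\<And>b. b \<in> Basis \<Longrightarrow> bump (F b)"
  shows "schwartz (tensor (\<lambda>b. fourier (F b)))"
proof (rule schwartz_tensor_of_towers)
  fix b :: 'a assume "b \<in> Basis"
  then obtain D where "schwartz_tower D" "D 0 = fourier (F b)"
    by (rule fourier_bump_tower[OF assms])
  then show "\<exists>D. schwartz_tower D \<and> D 0 = fourier (F b)" by blast
qed

lemma schwartz_tensor_inv_fourier:
  fixes F :: "'a::euclidean_space \<Rightarrow> real \<Rightarrow> complex"
  assumes "\<And>b. b \<in> Basis \<Longrightarrow> bump (F b)"
  shows "schwartz (tensor (\<lambda>b. inv_fourier (F b)))"
proof (rule schwartz_tensor_of_towers)
  fix b :: 'a assume "b \<in> Basis"
  then obtain D where "schwartz_tower D" "D 0 = inv_fourier (F b)"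
    by (rule inv_fourier_bump_tower[OF assms])
  then show "\<exists>D. schwartz_tower D \<and> D 0 = inv_fourier (F b)" by blast
qed

lemma fourier_bump_integrable:
  assumes "bump f"
  shows "integrable lborel (fourier f)"
proof -
  obtain D where "schwartz_tower D" "D 0 = fourier f" by (rule fourier_bump_tower[OF assms])
  then show ?thesis using schwartz_tower_integrable[of D 0] by simp
qed

lemma inv_fourier_bump_integrable:
  assumes "bump f"
  shows "integrable lborel (inv_fourier f)"
proof -
  obtain D where "schwartz_tower D" "D 0 = inv_fourier f" by (rule inv_fourier_bump_tower[OF assms])
  then show ?thesis using schwartz_tower_integrable[of D 0] by simp
qed

lemma integrable_mult_inv_fourier:
  fixes a \<phi> :: "'a::euclidean_space \<Rightarrow> complex"
  assumes a: "integrable lborel a" and \<phi>: "integrable lborel \<phi>"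
  shows "integrable lborel (\<lambda>x. a x * inv_fourier \<phi> x)"
proof -
  have [measurable]: "\<phi> \<in> borel_measurable lborel" using \<phi> by auto
  have "integrable lborel (\<lambda>x. inv_fourier \<phi> x * a x)"
  proof (rule integrable_bounded_mult[OF _ _ a])
    show "inv_fourier \<phi> \<in> borel_measurable borel"
      using inv_fourier_measurable[of \<phi>] by simp
    show "norm (inv_fourier \<phi> x) \<le> (2 * pi) powr (- real DIM('a) / 2) * (LINT x|lborel. norm (\<phi> x))" for x
      unfolding inv_fourier_eq_fourier_minus by (rule norm_fourier_le[OF \<phi>])
  qed
  then show ?thesis by (simp only: mult.commute)
qed

section \<open>Blocks of the test functions\<close>

context decomposition_profile
begin

text \<open>The teeth may be chosen separately in each coordinate, so that the function on the whole
  space and its restriction are instances of the same construction.\<close>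

definition comb_tensor :: "('a \<Rightarrow> int set) \<Rightarrow> 'a::euclidean_space \<Rightarrow> complex" where
  "comb_tensor J = tensor (\<lambda>b. inv_fourier (comb (J b)))"

definition slice_tensor :: "('a \<Rightarrow> int set) \<Rightarrow> 'a \<Rightarrow> 'a::euclidean_space \<Rightarrow> complex" where
  "slice_tensor J k = tensor (\<lambda>b. inv_fourier (slice (J b) (k \<bullet> b)))"

lemma schwartz_comb_tensor: "schwartz (comb_tensor J)"
  unfolding comb_tensor_def by (intro schwartz_tensor_inv_fourier bump_comb)

lemma fourier_comb_tensor: "fourier (comb_tensor J) = tensor (\<lambda>b. comb (J b))"
proof -
  have "fourier (comb_tensor J) = tensor (\<lambda>b. fourier (inv_fourier (comb (J b))))"
    unfolding comb_tensor_def by (intro fourier_tensor inv_fourier_bump_integrable bump_comb)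
  also have "\<dots> = tensor (\<lambda>b. comb (J b))"
    by (intro tensor_cong fourier_inv_fourier_bump bump_comb)
  finally show ?thesis .
qed

lemma psi_mult_comb_tensor:
  "of_real (psi \<eta> k \<xi>) * tensor (\<lambda>b. comb (J b)) \<xi> = tensor (\<lambda>b. slice (J b) (k \<bullet> b)) \<xi>"
  unfolding psi_eq_tensor tensor_mult psi_mult_comb ..

text \<open>Duality is used twice: the outer transform is moved onto the comb, where
  \<open>psi\<close> cuts out the slices, and then the inverse transform is moved from \<phi> onto
  them. Inversion enters only through the bumps in the comb.\<close>

lemma box_op_comb_tensor:
  fixes k :: "'a::euclidean_space"
  assumes \<phi>: "integrable lborel \<phi>"
  shows "box_op \<eta> k (\<lambda>\<phi>. LINT x|lborel. comb_tensor J x * \<phi> x) \<phi> =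
    (LINT x|lborel. slice_tensor J k x * \<phi> x)"
proof -
  define a where "a \<xi> = complex_of_real (psi \<eta> k \<xi>) * inv_fourier \<phi> \<xi>" for \<xi>
  have a: "integrable lborel a"
    unfolding a_def by (rule integrable_mult_inv_fourier[OF psi_integrable \<phi>])
  have slice: "integrable lborel (tensor (\<lambda>b. slice (J b) (k \<bullet> b)))"
    by (intro integrable_tensor bump_integrable bump_slice)
  have "box_op \<eta> k (\<lambda>\<phi>. LINT x|lborel. comb_tensor J x * \<phi> x) \<phi> =
      (LINT x|lborel. comb_tensor J x * fourier a x)"
    unfolding box_op_def inv_fourier_distr_def mult_distr_def fourier_distr_def a_def ..
  also have "\<dots> = (LINT x|lborel. fourier (comb_tensor J) x * a x)"
    by (rule integral_fourier_mult[symmetric, OF schwartz_integrable[OF schwartz_comb_tensor] a])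
  also have "\<dots> = (LINT \<xi>|lborel. tensor (\<lambda>b. slice (J b) (k \<bullet> b)) \<xi> * inv_fourier \<phi> \<xi>)"
    unfolding fourier_comb_tensor a_def psi_mult_comb_tensor[symmetric] by (simp only: mult_ac)
  also have "\<dots> = (LINT x|lborel. inv_fourier (tensor (\<lambda>b. slice (J b) (k \<bullet> b))) x * \<phi> x)"
    by (rule integral_inv_fourier_mult[symmetric, OF slice \<phi>])
  also have "inv_fourier (tensor (\<lambda>b. slice (J b) (k \<bullet> b))) = slice_tensor J k"
    unfolding slice_tensor_def by (intro inv_fourier_tensor bump_integrable bump_slice)
  finally show ?thesis .
qed

lemma represents_box_op_comb_tensor:
  fixes k :: "'a::euclidean_space"
  shows
  "represents (slice_tensor J k) (box_op \<eta> k (\<lambda>\<phi>. LINT x|lborel. comb_tensor J x * \<phi> x))"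
proof -
  have s: "schwartz (slice_tensor J k)"
    unfolding slice_tensor_def by (intro schwartz_tensor_inv_fourier bump_slice)
  show ?thesis
    unfolding represents_def
  proof (intro conjI allI impI)
    fix \<phi> :: "'a \<Rightarrow> complex" assume \<phi>: "schwartz \<phi>"
    show "box_op \<eta> k (\<lambda>\<phi>. LINT x|lborel. comb_tensor J x * \<phi> x) \<phi> =
        (LINT x|lborel. slice_tensor J k x * \<phi> x)"
      by (rule box_op_comb_tensor[OF schwartz_integrable[OF \<phi>]])
  qed (use schwartz_represents[OF s] in \<open>simp_all add: represents_def\<close>)
qed

text \<open>The slices decay uniformly, so the constant does not depend on the number of teeth or on
  the position of the block; this keeps the growth in N confined to the number of nonzero
  blocks.\<close>

lemma Lp_norm_distr_box_op_le:
  assumes p: "1 \<le> p"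
  obtains K where "0 \<le> K" "\<And>(J :: 'a \<Rightarrow> int set) (k :: 'a::euclidean_space). (\<And>b. finite (J b)) \<Longrightarrow> k \<in> int_lattice \<Longrightarrow>
    Lp_norm_distr p (box_op \<eta> k (\<lambda>\<phi>. LINT x|lborel. comb_tensor J x * \<phi> x)) \<le> ennreal K"
proof -
  obtain M where M: "1 \<le> M" "\<And>J k x. finite J \<Longrightarrow> k \<in> \<int> \<Longrightarrow>
    norm (inv_fourier (slice J k) x) \<le> M * inverse (1 + x\<^sup>2)"
    by (rule slice_decay) blast
  define w where "w x = (\<Prod>b\<in>Basis. inverse (1 + (x \<bullet> b)\<^sup>2))" for x :: 'a
  have i0: "0 \<le> inverse (1 + t\<^sup>2)" and i1: "inverse (1 + t\<^sup>2) \<le> 1" for t :: real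
    by (simp_all add: inverse_le_1_iff)
  have "integrable lborel (tensor (\<lambda>(b::'a) t. complex_of_real (inverse (1 + t\<^sup>2))))"
    by (intro integrable_tensor complex_of_real_integrable_eq[THEN iffD2] integrable_inverse_square_UNIV)
  moreover have "tensor (\<lambda>(b::'a) t. complex_of_real (inverse (1 + t\<^sup>2))) = (\<lambda>x. of_real (w x))"
    unfolding tensor_def w_def by (simp only: of_real_prod)
  ultimately have w: "integrable lborel w" by (simp only: complex_of_real_integrable_eq)
  have w0: "0 \<le> w x" for x unfolding w_def by (intro prod_nonneg i0)
  have w1: "w x \<le> 1" for x unfolding w_def by (intro prod_le_1 conjI i0 i1)
  obtain K where K: "0 \<le> K" "\<And>G :: 'a \<Rightarrow> complex. G \<in> borel_measurable borel \<Longrightarrow>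
      (\<And>x. norm (G x) \<le> M ^ DIM('a) * w x) \<Longrightarrow> Lp_norm p G \<le> ennreal K"
  proof (rule Lp_norm_le_dominated[OF p w w0 w1])
    show "0 \<le> M ^ DIM('a)" using M(1) by simp
  qed blast
  show thesis
  proof (rule that[OF K(1)])
    fix J :: "'a \<Rightarrow> int set" and k :: 'a
    assume J: "\<And>b. finite (J b)" and k: "k \<in> int_lattice"
    have "Lp_norm_distr p (box_op \<eta> k (\<lambda>\<phi>. LINT x|lborel. comb_tensor J x * \<phi> x)) \<le> Lp_norm p (slice_tensor J k)"
      unfolding Lp_norm_distr_def by (rule INF_lower) (simp add: represents_box_op_comb_tensor)
    also have "\<dots> \<le> ennreal K"
    proof (rule K(2))
      show "slice_tensor J k \<in> borel_measurable borel"
        unfolding slice_tensor_def by (intro schwartz_measurable schwartz_tensor_inv_fourier bump_slice)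
      fix x
      have "norm (slice_tensor J k x) = (\<Prod>b\<in>Basis. norm (inv_fourier (slice (J b) (k \<bullet> b)) (x \<bullet> b)))"
        unfolding slice_tensor_def tensor_def by (rule prod_norm[symmetric])
      also have "\<dots> \<le> (\<Prod>b\<in>Basis. M * inverse (1 + (x \<bullet> b)\<^sup>2))"
        using k unfolding int_lattice_def by (intro prod_mono conjI norm_ge_zero M(2) J) blast
      also have "\<dots> = M ^ DIM('a) * w x"
        unfolding w_def by (simp only: prod.distrib prod_constant)
      finally show "norm (slice_tensor J k x) \<le> M ^ DIM('a) * w x" .
    qed
    finally show "Lp_norm_distr p (box_op \<eta> k (\<lambda>\<phi>. LINT x|lborel. comb_tensor J x * \<phi> x)) \<le> ennreal K" .
  qed
qed

text \<open>One coordinate in which window and teeth do not meet annihilates the whole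
  tensor.\<close>

lemma Lp_norm_distr_box_op_eq_0:
  fixes k :: "'a::euclidean_space"
  assumes p: "1 \<le> p" and b: "b \<in> Basis" and far: "\<And>j. j \<in> J b \<Longrightarrow> 3 / 2 \<le> \<bar>k \<bullet> b - 3 * of_int j\<bar>"
  shows "Lp_norm_distr p (box_op \<eta> k (\<lambda>\<phi>. LINT x|lborel. comb_tensor J x * \<phi> x)) = 0"
proof -
  have "slice (J b) (k \<bullet> b) = (\<lambda>t. 0)" by (rule slice_eq_0) (rule far)
  then have "inv_fourier (slice (J b) (k \<bullet> b)) t = 0" for t by (simp add: inv_fourier_def)
  then have "slice_tensor J k = (\<lambda>x. 0)"
    unfolding slice_tensor_def tensor_def using b by (intro ext prod_zero) auto
  then have "Lp_norm_distr p (box_op \<eta> k (\<lambda>\<phi>. LINT x|lborel. comb_tensor J x * \<phi> x)) \<le> Lp_norm p (\<lambda>x::'a. 0)"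
    unfolding Lp_norm_distr_def using represents_box_op_comb_tensor[of J k] by (intro INF_lower) simp
  then show ?thesis by (simp add: Lp_norm_zero[OF p])
qed

end

section \<open>The counterexample\<close>

lemma finite_unit_lattice:
  "finite {k \<in> int_lattice. \<forall>b\<in>Basis. \<bar>(k :: 'a::euclidean_space) \<bullet> b\<bar> \<le> 1}" (is "finite ?F")
proof (rule finite_subset)
  let ?g = "\<lambda>f :: 'a \<Rightarrow> real. \<Sum>b\<in>Basis. f b *\<^sub>R b"
  let ?P = "PiE (Basis :: 'a set) (\<lambda>_. {-1, 0, 1 :: real})"
  show "?F \<subseteq> ?g ` ?P"
  proof
    fix k assume k: "k \<in> ?F"
    have "k \<bullet> b \<in> {-1, 0, 1}" if b: "b \<in> Basis" for b
    proof -
      have "k \<bullet> b \<in> \<int>" "\<bar>k \<bullet> b\<bar> \<le> 1" using k b unfolding int_lattice_def by blast+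
      then obtain i where i: "k \<bullet> b = of_int i" by (meson Ints_cases)
      with \<open>\<bar>k \<bullet> b\<bar> \<le> 1\<close> have "\<bar>i\<bar> \<le> 1" by linarith
      then have "i = -1 \<or> i = 0 \<or> i = 1" by linarith
      then show ?thesis unfolding i by auto
    qed
    then have mem: "restrict (\<lambda>b. k \<bullet> b) Basis \<in> ?P" by (simp only: restrict_PiE_iff) blast
    have "?g (restrict (\<lambda>b. k \<bullet> b) Basis) = (\<Sum>b\<in>Basis. (k \<bullet> b) *\<^sub>R b)"
      by (intro sum.cong) simp_all
    then have "?g (restrict (\<lambda>b. k \<bullet> b) Basis) = k" by (simp only: euclidean_representation)
    with imageI[OF mem, of ?g] show "k \<in> ?g ` ?P" by simp
  qed
  show "finite (?g ` ?P)" by (intro finite_imageI finite_PiE) auto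
qed

lemma int_lattice_pair:
  assumes "k \<in> int_lattice" "kn \<in> \<int>"
  shows "(k :: 'a::euclidean_space, kn :: real) \<in> int_lattice"
  using assms unfolding int_lattice_def Basis_prod_def by (auto simp: Basis_real_def)

text \<open>Comparison with an indicator function, phrased for complex integrals because it is
  applied to frequency profiles. It provides the explicit lower bounds that keep the final constants
  away from 0.\<close>

lemma integral_of_real_ge:
  fixes u :: "real \<Rightarrow> real"
  assumes "integrable lborel (\<lambda>t. complex_of_real (u t))" and u0: "\<And>t. 0 \<le> u t"
    and u1: "\<And>t. t \<in> {a..b} \<Longrightarrow> 1 \<le> u t" and ab: "a \<le> b"
  obtains \<rho> where "b - a \<le> \<rho>" "(LINT t|lborel. complex_of_real (u t)) = of_real \<rho>"
proof
  have u: "integrable lborel u" using assms(1) by (simp only: complex_of_real_integrable_eq)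
  have "integrable lborel (indicat_real {a..b})"
    using ab by (intro integrable_real_indicator) simp_all
  then have "(LINT t|lborel. indicat_real {a..b} t) \<le> (LINT t|lborel. u t)"
    using u by (rule integral_mono) (use u0 u1 in \<open>simp add: indicator_def\<close>)
  then show "b - a \<le> (LINT t|lborel. u t)" using ab by simp
  show "(LINT t|lborel. complex_of_real (u t)) = of_real (LINT t|lborel. u t)"
    by (rule integral_complex_of_real)
qed

section \<open>Growth of the two norms\<close>

context decomposition_profile
begin

lemma eta4_eq_1: "\<bar>t\<bar> \<le> 1 / 4 \<Longrightarrow> \<eta> (4 * t) = 1"
  by (rule eta_eq_1) (simp add: abs_mult)

text \<open>Every tooth contributes at least 1/2: it is nonnegative, and within 1/4 of its centre it
  equals \<open>eta_sum\<close>, which is at least 1.\<close>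

lemma integral_comb:
  obtains \<rho> where "real (card J) / 2 \<le> \<rho>" "(LINT t|lborel. comb J t) = of_real \<rho>"
proof -
  have "\<exists>\<rho>. 1 / 2 \<le> \<rho> \<and> (LINT t|lborel. comb {j} t) = of_real \<rho>" for j
  proof -
    have c: "comb {j} t = of_real (eta_sum t * \<eta> (4 * (t - 3 * of_int j)))" for t
      by (simp add: comb_def)
    define a where "a = 3 * real_of_int j - 1 / 4"
    define b where "b = 3 * real_of_int j + 1 / 4"
    obtain \<rho> where "b - a \<le> \<rho>"
      "(LINT t|lborel. complex_of_real (eta_sum t * \<eta> (4 * (t - 3 * of_int j)))) = of_real \<rho>"
    proof (rule integral_of_real_ge)
      show "integrable lborel (\<lambda>t. complex_of_real (eta_sum t * \<eta> (4 * (t - 3 * of_int j))))"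
        using bump_integrable[OF bump_comb[of "{j}"]] unfolding c[abs_def] .
      show "0 \<le> eta_sum t * \<eta> (4 * (t - 3 * of_int j))" for t
        using eta_sum_ge_1[of t] eta_nonneg by simp
      show "1 \<le> eta_sum t * \<eta> (4 * (t - 3 * of_int j))" if "t \<in> {a..b}" for t
      proof -
        have "\<bar>t - 3 * of_int j\<bar> \<le> 1 / 4" using that unfolding a_def b_def abs_le_iff by simp
        from eta4_eq_1[OF this] show ?thesis using eta_sum_ge_1[of t] by simp
      qed
      show "a \<le> b" unfolding a_def b_def by simp
    qed blast
    then show ?thesis unfolding c a_def b_def by (intro exI[of _ \<rho>]) simp
  qed
  then obtain \<rho> where \<rho>: "\<And>j. 1 / 2 \<le> \<rho> j" "\<And>j. (LINT t|lborel. comb {j} t) = of_real (\<rho> j)"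
    by metis
  have "comb J t = (\<Sum>j\<in>J. comb {j} t)" for t
    by (simp add: comb_def sum_distrib_left)
  then have "(LINT t|lborel. comb J t) = (\<Sum>j\<in>J. LINT t|lborel. comb {j} t)"
    by (simp add: Bochner_Integration.integral_sum bump_integrable bump_comb)
  also have "\<dots> = of_real (\<Sum>j\<in>J. \<rho> j)" by (simp add: \<rho>(2))
  finally have "(LINT t|lborel. comb J t) = of_real (\<Sum>j\<in>J. \<rho> j)" .
  moreover have "real (card J) / 2 \<le> (\<Sum>j\<in>J. \<rho> j)"
    using sum_bounded_below[of J "1 / 2" \<rho>] \<rho>(1) by simp
  ultimately show thesis using that by blast
qed

text \<open>The vector (0, 1) spans the coordinate normal to the hyperplane, the only one that
  carries N teeth.\<close>

definition comb_family :: "nat \<Rightarrow> 'a::euclidean_space \<times> real \<Rightarrow> int set" where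
  "comb_family N b = (if b = (0, 1) then {0..<int N} else {0})"

definition comb_distr :: "nat \<Rightarrow> ('a::euclidean_space \<times> real) distr" where
  "comb_distr N = (\<lambda>\<phi>. LINT x|lborel. comb_tensor (comb_family N) x * \<phi> x)"

lemma comb_tensor_trace:
  "comb_tensor (comb_family N) (x :: 'a::euclidean_space, 0) =
    inv_fourier (comb {0..<int N}) 0 * comb_tensor (\<lambda>_. {0}) x"
proof -
  let ?G = "\<lambda>b. inv_fourier (comb (comb_family N b)) ((x, 0) \<bullet> b)"
  have "comb_tensor (comb_family N) (x, 0) =
      prod ?G ((\<lambda>u. (u, 0)) ` Basis \<union> (\<lambda>v. (0, v)) ` Basis)"
    unfolding comb_tensor_def tensor_def Basis_prod_def ..
  also have "\<dots> = prod ?G ((\<lambda>u. (u, 0)) ` Basis) * prod ?G ((\<lambda>v. (0, v)) ` Basis)"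
    by (rule prod.union_disjoint) (auto simp: nonzero_Basis)
  also have "prod ?G ((\<lambda>u. (u, 0)) ` Basis) = comb_tensor (\<lambda>_. {0}) x"
    unfolding comb_tensor_def tensor_def
    by (subst prod.reindex) (auto simp: inj_on_def comb_family_def intro!: prod.cong)
  also have "prod ?G ((\<lambda>v. (0, v)) ` Basis) = inv_fourier (comb {0..<int N}) 0"
    by (simp add: comb_family_def)
  finally show ?thesis by (simp only: mult.commute)
qed

text \<open>In the tangential coordinates there is only the tooth at 0, so the inner norm sees a set
  of blocks independent of N. The number of teeth enters only through the outer sum.\<close>

lemma amod_norm_comb_distr_le:
  assumes p: "1 \<le> p" and q: "1 \<le> q" and r: "1 \<le> r"
  obtains D where "0 \<le> D" "\<And>N. 1 \<le> N \<Longrightarrow>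
    amod_norm \<eta> p q r (comb_distr N :: ('a::euclidean_space \<times> real) distr)
      \<le> ennreal (real (3 * N) powr (1 / enn2real r) * D)"
proof -
  obtain K where K: "0 \<le> K" "\<And>(J :: 'a \<times> real \<Rightarrow> int set) k. (\<And>b. finite (J b)) \<Longrightarrow> k \<in> int_lattice \<Longrightarrow>
    Lp_norm_distr p (box_op \<eta> k (\<lambda>\<phi>. LINT x|lborel. comb_tensor J x * \<phi> x)) \<le> ennreal K"
    by (rule Lp_norm_distr_box_op_le[OF p]) blast
  define F where "F = {k \<in> int_lattice. \<forall>b\<in>Basis. \<bar>(k :: 'a) \<bullet> b\<bar> \<le> 1}"
  have F: "finite F" "F \<subseteq> int_lattice" "0 \<in> F"
    unfolding F_def by (rule finite_unit_lattice) (auto simp: int_lattice_def)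
  define D where "D = real (card F) powr (1 / enn2real q) * K"
  have D0: "0 \<le> D" unfolding D_def using K(1) by simp
  show thesis
  proof (rule that[OF D0])
    fix N :: nat assume N: "1 \<le> N"
    let ?J = "comb_family N :: 'a \<times> real \<Rightarrow> int set"
    define a where "a kn k = Lp_norm_distr p (box_op \<eta> (k :: 'a, kn) (comb_distr N))" for kn k
    have inner: "lq_norm q int_lattice (a kn) \<le> ennreal D" if kn: "kn \<in> \<int>" for kn
      unfolding D_def
    proof (rule lq_norm_finite_support_le[OF q F(1) _ F(2) _ _ K(1)])
      show "F \<noteq> {}" using F(3) by blast
      show "a kn k \<le> ennreal K" if "k \<in> F" for k
        unfolding a_def comb_distr_def
        by (rule K(2)) (use that F(2) kn in \<open>auto intro!: int_lattice_pair simp: comb_family_def\<close>)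
      fix k assume k: "k \<in> int_lattice - F"
      then obtain b where b: "b \<in> Basis" "\<not> \<bar>k \<bullet> b\<bar> \<le> 1" "k \<bullet> b \<in> \<int>"
        unfolding F_def int_lattice_def by blast
      show "a kn k = 0"
        unfolding a_def comb_distr_def
      proof (rule Lp_norm_distr_box_op_eq_0[OF p])
        show "(b, 0) \<in> (Basis :: ('a \<times> real) set)" using b(1) by (simp add: Basis_prod_def)
        fix j assume "j \<in> ?J (b, 0)"
        then have j: "j = 0" unfolding comb_family_def by (simp split: if_splits)
        obtain i where i: "k \<bullet> b = of_int i" using b(3) by (rule Ints_cases)
        have "\<not> \<bar>i\<bar> \<le> 1" using b(2) unfolding i by linarith
        then have "2 \<le> \<bar>i\<bar>" by linarith
        then have "(2 :: real) \<le> \<bar>of_int i\<bar>" by linarith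
        then show "3 / 2 \<le> \<bar>(k, kn) \<bullet> (b, 0) - 3 * of_int j\<bar>" using i j by simp
      qed
    qed
    \<comment> \<open>The union of {3j - 1, 3j, 3j + 1} for j from 0 to N - 1, that is, the integers
      from -1 to 3N - 2.\<close>
    define F' :: "real set" where "F' = of_int ` {-1..<3 * int N - 1}"
    have F': "finite F'" "F' \<subseteq> \<int>" "F' \<noteq> {}" "card F' = 3 * N"
      unfolding F'_def using N by (auto simp: card_image inj_on_def)
    have "amod_norm \<eta> p q r (comb_distr N :: ('a \<times> real) distr) = lq_norm r \<int> (\<lambda>kn. lq_norm q int_lattice (a kn))"
      unfolding amod_norm_def a_def ..
    also have "\<dots> \<le> ennreal (real (card F') powr (1 / enn2real r) * D)"
    proof (rule lq_norm_finite_support_le[OF r F'(1,3,2) _ _ D0])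
      show "lq_norm q int_lattice (a kn) \<le> ennreal D" if "kn \<in> F'" for kn
        using that F'(2) inner by blast
      fix kn assume kn: "kn \<in> \<int> - F'"
      then obtain i where i: "kn = of_int i" by (meson DiffD1 Ints_cases)
      have far: "i \<notin> {-1..<3 * int N - 1}" using kn unfolding F'_def i by blast
      have 0: "a kn k = 0" for k
        unfolding a_def comb_distr_def
      proof (rule Lp_norm_distr_box_op_eq_0[OF p])
        show "(0, 1) \<in> (Basis :: ('a \<times> real) set)" by (simp add: Basis_prod_def)
        fix j assume "j \<in> ?J (0, 1)"
        then have "0 \<le> j" "j < int N" unfolding comb_family_def by simp_all
        then have "2 \<le> \<bar>i - 3 * j\<bar>" using far by (simp add: abs_le_iff) linarith
        then have "(2 :: real) \<le> \<bar>of_int (i - 3 * j)\<bar>" by linarith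
        then show "3 / 2 \<le> \<bar>(k, kn) \<bullet> (0, 1) - 3 * of_int j\<bar>" using i by simp
      qed
      have "lq_norm q int_lattice (a kn) \<le> ennreal (real (card F) powr (1 / enn2real q) * 0)"
        by (rule lq_norm_finite_support_le[OF q F(1) _ F(2)]) (use F(3) 0 in auto)
      then show "lq_norm q int_lattice (a kn) = 0" by simp
    qed
    finally show "amod_norm \<eta> p q r (comb_distr N :: ('a \<times> real) distr)
      \<le> ennreal (real (3 * N) powr (1 / enn2real r) * D)" unfolding F'(4) .
  qed
qed

text \<open>The block at 0 and one test function suffice. \<phi> is the transform of a comb, so
  \<open>psi\<close> cuts an explicit slice out of its inverse transform and the block at \<phi> is
  the value of g at the Schwartz function \<theta>. That value follows from the representation of g,
  and it contains the factor v(0).\<close>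

lemma mod_norm_trace_ge:
  assumes p: "1 \<le> p" and q: "1 \<le> q"
  obtains c where "0 < c" "\<And>N g. represents (\<lambda>x :: 'a::euclidean_space. comb_tensor (comb_family N) (x, 0)) g \<Longrightarrow>
    ennreal (real N * c) \<le> mod_norm \<eta> p q g"
proof -
  define \<phi> where "\<phi> = (tensor (\<lambda>b. fourier (comb {0})) :: 'a \<Rightarrow> complex)"
  define \<theta> where "\<theta> = (tensor (\<lambda>b. fourier (slice {0} 0)) :: 'a \<Rightarrow> complex)"
  have \<phi>: "schwartz \<phi>" unfolding \<phi>_def by (intro schwartz_tensor_fourier bump_comb)
  have \<theta>: "schwartz \<theta>" unfolding \<theta>_def by (intro schwartz_tensor_fourier bump_slice)
  have box: "box_op \<eta> 0 g \<phi> = g \<theta>" for g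
  proof -
    have "inv_fourier \<phi> = tensor (\<lambda>b. inv_fourier (fourier (comb {0})))"
      unfolding \<phi>_def by (intro inv_fourier_tensor fourier_bump_integrable bump_comb)
    also have "\<dots> = tensor (\<lambda>b. comb {0})"
      by (intro tensor_cong inv_fourier_fourier_bump bump_comb)
    finally have i\<phi>: "inv_fourier \<phi> = tensor (\<lambda>b. comb {0})" .
    have "(\<lambda>\<xi>. of_real (psi \<eta> 0 \<xi>) * inv_fourier \<phi> \<xi>) = tensor (\<lambda>b. slice {0} 0)"
      unfolding i\<phi> using psi_mult_comb_tensor[of 0 _ "\<lambda>_. {0}"] by (intro ext) (simp only: inner_zero_left)
    moreover have "fourier (tensor (\<lambda>b. slice {0} 0)) = \<theta>"
      unfolding \<theta>_def by (intro fourier_tensor bump_integrable bump_slice)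
    ultimately show ?thesis
      unfolding box_op_def inv_fourier_distr_def mult_distr_def fourier_distr_def by simp
  qed
  \<comment> \<open>One coordinate of the pairing: the integrand is nonnegative and at least 1 on
    [-1/4, 1/4], an interval of length 1/2.\<close>
  obtain \<kappa> where \<kappa>: "1 / 2 \<le> \<kappa>" "(LINT t|lborel. comb {0} t * slice {0} 0 t) = of_real \<kappa>"
  proof -
    let ?u = "\<lambda>t. eta_sum t * \<eta> (4 * t) * (\<eta> (2 * t) * \<eta> (4 * t))"
    have u: "comb {0} t * slice {0} 0 t = of_real (?u t)" for t
      by (simp add: comb_def slice_def)
    have "bump (\<lambda>t. comb {0} t * slice {0} 0 t)"
      by (rule bump_mult[OF _ bump_slice]) (use bump_comb in \<open>simp add: bump_def\<close>)
    then have i: "integrable lborel (\<lambda>t. complex_of_real (?u t))"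
      unfolding u by (rule bump_integrable)
    have u0: "0 \<le> ?u t" for t
      using eta_sum_ge_1[of t] by (intro mult_nonneg_nonneg eta_nonneg) simp
    have u1: "1 \<le> ?u t" if "t \<in> {-(1/4)..1/4}" for t
    proof -
      have t: "\<bar>t\<bar> \<le> 1 / 4" using that unfolding abs_le_iff by simp
      then have "\<eta> (4 * t) = 1" "\<eta> (2 * t) = 1"
        using eta4_eq_1 by (simp, intro eta_eq_1) (simp add: abs_mult)
      then show ?thesis using eta_sum_ge_1[of t] by simp
    qed
    obtain \<rho> where \<rho>: "1 / 4 - (-(1/4)) \<le> \<rho>" "(LINT t|lborel. complex_of_real (?u t)) = of_real \<rho>"
      by (rule integral_of_real_ge[of ?u "-(1/4)" "1/4", OF i u0 u1]) (assumption, simp, blast)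
    show thesis
    proof (rule that)
      show "1 / 2 \<le> \<rho>" using \<rho>(1) by simp
      show "(LINT t|lborel. comb {0} t * slice {0} 0 t) = of_real \<rho>" unfolding u by (rule \<rho>(2))
    qed
  qed
  obtain B where B: "\<And>x. norm (\<phi> x) \<le> B" using schwartz_bounded[OF \<phi>] by blast
  \<comment> \<open>The bound is enlarged because a strictly positive one is required.\<close>
  then have B': "norm (\<phi> x) \<le> \<bar>B\<bar> + 1" for x using B[of x] by linarith
  define K where "K = (\<bar>B\<bar> + 1) + (LINT x|lborel. norm (\<phi> x))"
  have "0 \<le> (LINT x|lborel. norm (\<phi> x))" by simp
  then have K: "0 < K" unfolding K_def by linarith
  define c0 where "c0 = (2 * pi) powr (- 1 / 2)"
  define c where "c = c0 / 2 * \<kappa> ^ DIM('a) / K"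
  have c0: "0 < c0" unfolding c0_def by simp
  have "0 < c" unfolding c_def using c0 K \<kappa>(1) by simp
  moreover have "ennreal (real N * c) \<le> mod_norm \<eta> p q g"
    if g: "represents (\<lambda>x :: 'a. comb_tensor (comb_family N) (x, 0)) g" for N g
  proof -
    define v where "v = inv_fourier (comb {0..<int N}) 0"
    obtain \<rho> where \<rho>: "real (card {0..<int N}) / 2 \<le> \<rho>" "(LINT t|lborel. comb {0..<int N} t) = of_real \<rho>"
      by (rule integral_comb)
    \<comment> \<open>At the origin the character is 1, so v is the bare integral of the comb times
      the normalising constant.\<close>
    have "v = of_real (c0 * \<rho>)"
      unfolding v_def inv_fourier_def c0_def using \<rho>(2) by simp
    then have "c0 * \<rho> \<le> norm v" by (simp only: norm_of_real abs_ge_self)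
    moreover have "c0 * (real N / 2) \<le> c0 * \<rho>" using \<rho>(1) c0 by simp
    ultimately have v: "c0 / 2 * real N \<le> norm v" by simp
    have "g \<theta> = (LINT x|lborel. v * (comb_tensor (\<lambda>_. {0}) x * \<theta> x))"
      using g \<theta> unfolding represents_def comb_tensor_trace v_def by (simp only: mult.assoc)
    also have "\<dots> = v * (LINT x|lborel. tensor (\<lambda>b. inv_fourier (comb {0})) x * \<theta> x)"
      unfolding comb_tensor_def by (rule integral_mult_right_zero)
    also have "(LINT x|lborel. tensor (\<lambda>b. inv_fourier (comb {0})) x * \<theta> x) =
        (LINT x|lborel. fourier (tensor (\<lambda>b. inv_fourier (comb {0}))) (x :: 'a) * tensor (\<lambda>b. slice {0} 0) x)"
    proof -
      have \<theta>': "\<theta> = fourier (tensor (\<lambda>b. slice {0} 0))"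
        unfolding \<theta>_def by (intro fourier_tensor[symmetric] bump_integrable bump_slice)
      show ?thesis
        unfolding \<theta>'
        by (intro integral_fourier_mult[symmetric] integrable_tensor inv_fourier_bump_integrable
            bump_comb bump_integrable bump_slice)
    qed
    also have "fourier (tensor (\<lambda>b. inv_fourier (comb {0}))) = (tensor (\<lambda>b. comb {0}) :: 'a \<Rightarrow> complex)"
      using fourier_comb_tensor[of "\<lambda>_. {0}"] unfolding comb_tensor_def .
    also have "(LINT x|lborel. (tensor (\<lambda>b. comb {0}) :: 'a \<Rightarrow> complex) x * tensor (\<lambda>b. slice {0} 0) x) =
        (\<Prod>b\<in>(Basis :: 'a set). LINT t|lborel. comb {0} t * slice {0} 0 t)"
      unfolding tensor_mult
      by (intro integral_tensor bump_integrable bump_mult[OF _ bump_slice]) (use bump_comb in \<open>simp add: bump_def\<close>)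
    also have "\<dots> = of_real \<kappa> ^ DIM('a)" by (simp only: \<kappa>(2) prod_constant)
    finally have "norm (g \<theta>) = norm v * \<kappa> ^ DIM('a)"
      using \<kappa>(1) by (simp add: norm_mult norm_power)
    then have "c0 / 2 * real N * \<kappa> ^ DIM('a) \<le> norm (g \<theta>)"
      using v \<kappa>(1) by (simp add: mult_right_mono)
    then have "real N * c \<le> norm (g \<theta>) / K"
      unfolding c_def using K by (simp add: field_simps)
    then have "ennreal (real N * c) \<le> ennreal (norm (box_op \<eta> 0 g \<phi>) / K)"
      unfolding box by (rule ennreal_leI)
    also have "\<dots> \<le> Lp_norm_distr p (box_op \<eta> 0 g)"
      unfolding K_def by (rule Lp_norm_distr_ge[OF p \<phi> B']) simp
    also have "\<dots> \<le> mod_norm \<eta> p q g"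
      unfolding mod_norm_def by (rule lq_norm_member[OF q]) (simp add: int_lattice_def)
    finally show ?thesis .
  qed
  ultimately show thesis by (rule that)
qed

text \<open>The distribution is represented by a Schwartz function, so its trace is an ordinary
  restriction. The representative chosen there is existential; uniqueness identifies it with the
  explicit tensor.\<close>

lemma represents_trace_comb_distr:
  assumes "has_trace \<eta> (comb_distr N :: ('a::euclidean_space \<times> real) distr) g"
  shows "represents (\<lambda>x. comb_tensor (comb_family N) (x, 0)) g"
proof -
  let ?h = "comb_tensor (comb_family N) :: 'a \<times> real \<Rightarrow> complex"
  have h: "schwartz ?h" by (rule schwartz_comb_tensor)
  have rh: "represents ?h (comb_distr N)"
    unfolding comb_distr_def by (rule schwartz_represents[OF h])
  then obtain h' where h': "schwartz h'" "represents h' (comb_distr N :: ('a \<times> real) distr)"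
    "represents (\<lambda>x. h' (x, 0)) g"
    using assms h unfolding has_trace_def by (auto split: if_splits)
  have "h' = ?h"
  proof (rule schwartz_eqI[OF h'(1) h])
    fix \<phi> :: "'a \<times> real \<Rightarrow> complex" assume "schwartz \<phi>"
    then show "(LINT x|lborel. h' x * \<phi> x) = (LINT x|lborel. ?h x * \<phi> x)"
      using h'(2) rh unfolding represents_def by metis
  qed
  with h'(3) show ?thesis by simp
qed

end

text \<open>With d = 1 - s > 0 the hypothesis says that N^d c stays below E. The witness is chosen
  to make N^d at least |E| / c + 1, which forces |E| + c to be at most E.\<close>

lemma linear_not_le_powr:
  assumes "0 < c" "s < 1" "\<And>N::nat. 1 \<le> N \<Longrightarrow> real N * c \<le> E * real N powr s"
  shows False
proof -
  define d where "d = 1 - s"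
  have d: "0 < d" using assms(2) by (simp add: d_def)
  define x where "x = (\<bar>E\<bar> / c + 1) powr (1 / d)"
  define N where "N = nat \<lceil>x\<rceil> + 1"
  have x0: "0 < \<bar>E\<bar> / c + 1" using assms(1) by (simp add: add_nonneg_pos)
  have N: "1 \<le> N" "x \<le> real N" unfolding N_def by linarith+
  have "\<bar>E\<bar> / c + 1 = x powr d" unfolding x_def using d x0 by (simp add: powr_powr)
  also have "\<dots> \<le> real N powr d" using N d by (intro powr_mono2) (auto simp: x_def)
  finally have "\<bar>E\<bar> + c \<le> real N powr d * c" using assms(1) by (simp add: field_simps)
  then have "(\<bar>E\<bar> + c) * real N powr s \<le> real N powr d * c * real N powr s"
    by (rule mult_right_mono) simp
  also have "\<dots> = real N * c"
    using N(1) by (simp add: d_def powr_diff)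
  also have "\<dots> \<le> E * real N powr s" using assms(3)[OF N(1)] .
  finally have "\<bar>E\<bar> + c \<le> E" using N(1) by (simp add: mult_le_cancel_right)
  with assms(1) show False by linarith
qed

theorem mainTheorem3:
  fixes n :: nat and p q r :: ennreal and \<eta> :: "real \<Rightarrow> real"
  assumes "n \<ge> 2" and "CARD('m::finite) = n - 1"
    and "1 \<le> p" and "1 \<le> q" and "1 < r"
    and "smooth \<eta>" and "\<And>t. 0 \<le> \<eta> t \<and> \<eta> t \<le> 1"
    and "\<And>t. \<bar>t\<bar> \<le> 1 \<Longrightarrow> \<eta> t = 1" and "\<And>t. \<bar>t\<bar> \<ge> 2 \<Longrightarrow> \<eta> t = 0"
  shows "\<not> (\<exists>C::real. C > 0 \<and>
    (\<forall>f \<in> (amod_space \<eta> p q r :: ((real ^ 'm) \<times> real) distr set).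
       \<exists>g. has_trace \<eta> f g \<and> g \<in> mod_space \<eta> p q \<and>
           mod_norm \<eta> p q g \<le> ennreal C * amod_norm \<eta> p q r f))"
proof (rule notI, elim exE conjE)
  fix C :: real
  assume C: "0 < C" and bound: "\<forall>f \<in> (amod_space \<eta> p q r :: ((real ^ 'm) \<times> real) distr set).
       \<exists>g. has_trace \<eta> f g \<and> g \<in> mod_space \<eta> p q \<and>
           mod_norm \<eta> p q g \<le> ennreal C * amod_norm \<eta> p q r f"
  interpret decomposition_profile \<eta>
    using assms(6-9) by unfold_locales simp_all
  have r: "1 \<le> r" using assms(5) by simp
  define s where "s = 1 / enn2real r"
  \<comment> \<open>For infinite r, \<open>enn2real\<close> gives 0 and division by 0 gives 0, so s
    = 0 and this endpoint needs no separate estimate.\<close>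
  have s: "s < 1"
  proof (cases "r = \<infinity>")
    case False
    then have "r < top" by (simp add: less_top)
    then have "enn2real 1 < enn2real r" using assms(5) by (intro enn2real_less_iff[THEN iffD2]) simp_all
    then show ?thesis unfolding s_def by simp
  qed (simp add: s_def)
  obtain D where D: "0 \<le> D" "\<And>N. 1 \<le> N \<Longrightarrow>
    amod_norm \<eta> p q r (comb_distr N :: ((real ^ 'm) \<times> real) distr) \<le> ennreal (real (3 * N) powr s * D)"
    unfolding s_def by (rule amod_norm_comb_distr_le[OF assms(3,4) r]) blast
  obtain c where c: "0 < c" "\<And>N g. represents (\<lambda>x :: real ^ 'm. comb_tensor (comb_family N) (x, 0)) g \<Longrightarrow>
    ennreal (real N * c) \<le> mod_norm \<eta> p q g"
    by (rule mod_norm_trace_ge[OF assms(3,4)]) blast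
  show False
  proof (rule linear_not_le_powr[OF c(1) s])
    fix N :: nat assume N: "1 \<le> N"
    let ?f = "comb_distr N :: ((real ^ 'm) \<times> real) distr"
    have "?f \<in> amod_space \<eta> p q r"
      unfolding amod_space_def
    proof (intro CollectI conjI)
      show "tempered ?f"
        unfolding comb_distr_def by (rule integral_functional_tempered[OF schwartz_comb_tensor])
      show "amod_norm \<eta> p q r ?f < \<infinity>" using D(2)[OF N] by (simp add: le_less_trans)
    qed
    with bound obtain g where g: "has_trace \<eta> ?f g" "mod_norm \<eta> p q g \<le> ennreal C * amod_norm \<eta> p q r ?f"
      by meson
    have "ennreal (real N * c) \<le> mod_norm \<eta> p q g"
      by (rule c(2)[OF represents_trace_comb_distr[OF g(1)]])
    also have "\<dots> \<le> ennreal C * ennreal (real (3 * N) powr s * D)"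
      by (rule order_trans[OF g(2)]) (intro mult_left_mono D(2) N, simp)
    also have "\<dots> = ennreal (C * (real (3 * N) powr s * D))"
      using C D(1) by (intro ennreal_mult[symmetric]) simp_all
    finally have "real N * c \<le> C * (real (3 * N) powr s * D)"
      using C D(1) by (subst (asm) ennreal_le_iff) simp_all
    then show "real N * c \<le> (C * 3 powr s * D) * real N powr s"
      by (simp add: powr_mult mult_ac)
  qed
qed

end
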